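(* Let $m\ge2$ be an even integer and $n\ge1$ an integer. Then $$\mathrm{M}(C_{m,n})=\sqrt{\prod_{k=1}^{n}\Big[1+\Big(\cos\tfrac{k\pi}{n+1}+\sqrt{1+\cos^2\tfrac{k\pi}{n+1}}\Big)^{m}\Big]\Big[1+\Big(\cos\tfrac{k\pi}{n+1}-\sqrt{1+\cos^2\tfrac{k\pi}{n+1}}\Big)^{m}\Big]}$$ $$=2^{\,n-2\lfloor n/2\rfloor}\prod_{k=1}^{\lfloor n/2\rfloor}\Big[1+\Big(\cos\tfrac{k\pi}{n+1}+\sqrt{1+\cos^2\tfrac{k\pi}{n+1}}\Big)^{m}\Big]\Big[1+\Big(\cos\tfrac{k\pi}{n+1}-\sqrt{1+\cos^2\tfrac{k\pi}{n+1}}\Big)^{m}\Big].$$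
   Context: The square cylinder graph $C_{m,n}$ is obtained from the $m\times n$ grid graph with vertex set $\{(i,j)\in\mathbb Z^2: 0\le i\le m-1,\ 0\le j\le n-1\}$ (two vertices adjacent when at Euclidean distance $1$) by adding, for each $j=0,\dots,n-1$, an edge joining $(0,j)$ to $(m-1,j)$ (when $m=2$ these added edges are parallel to existing edges, giving a multigraph). Thus $C_{m,n}$ consists of $n$ cycles of length $m$ ("girth" $m$) joined in a row. $\mathrm{M}(G)$ denotes the number of perfect matchings of $G$. *)

theory Defs
  imports Complex_Main "HOL-Analysis.Product_Vector"
begin

text \<open>Finite undirected multigraphs: edges are abstract objects, so that several of them may
  have the same set of end vertices.\<close>

record ('v, 'e) multigraph =
  vertices :: "'v set"
  edges :: "'e set"
  ends :: "'e \<Rightarrow> 'v set"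

definition perfect_matching :: "('v, 'e) multigraph \<Rightarrow> 'e set \<Rightarrow> bool" where
  "perfect_matching G S \<longleftrightarrow>
     S \<subseteq> edges G \<and> (\<forall>v \<in> vertices G. \<exists>!e. e \<in> S \<and> v \<in> ends G e)"

text \<open>Matchings are sets of edges, not of end vertex pairs: choosing a different one among
  parallel edges gives a different matching.\<close>

definition num_perfect_matchings :: "('v, 'e) multigraph \<Rightarrow> nat" where
  "num_perfect_matchings G = card {S. perfect_matching G S}"

definition grid_vertices :: "nat \<Rightarrow> nat \<Rightarrow> (int \<times> int) set" where
  "grid_vertices m n = {(i, j). 0 \<le> i \<and> i \<le> int m - 1 \<and> 0 \<le> j \<and> j \<le> int n - 1}"

text \<open>The library metric on \<^typ>\<open>int \<times> int\<close> is the Euclidean one.\<close>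

definition grid_edges :: "nat \<Rightarrow> nat \<Rightarrow> (int \<times> int) set set" where
  "grid_edges m n = {{u, v} | u v. u \<in> grid_vertices m n \<and> v \<in> grid_vertices m n \<and> dist u v = 1}"

text \<open>The edge \<open>Wrap j\<close> joins \<open>(0, j)\<close> to \<open>(m - 1, j)\<close>. For \<open>m = 2\<close> it is parallel to, but
  different from, the grid edge with the same ends.\<close>

datatype cylinder_edge = Grid "(int \<times> int) set" | Wrap int

primrec cylinder_ends :: "nat \<Rightarrow> cylinder_edge \<Rightarrow> (int \<times> int) set" where
  "cylinder_ends m (Grid e) = e"
| "cylinder_ends m (Wrap j) = {(0, j), (int m - 1, j)}"

definition cylinder :: "nat \<Rightarrow> nat \<Rightarrow> (int \<times> int, cylinder_edge) multigraph" where
  "cylinder m n =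
     \<lparr>vertices = grid_vertices m n,
      edges = Grid ` grid_edges m n \<union> Wrap ` {0..int n - 1},
      ends = cylinder_ends m\<rparr>"

end

(* Superposing a matching with the brick-wall matching of horizontal edges and reading the cylinder
   around its girth turns the matching into non-colliding particles on a path of length n: each used
   vertical edge is a particle hopping from its white to its black end. Since hops go to adjacent
   sites, the particles never change their order, so the number of ways to get from P to Q is a minor
   of a product B of elementary matrices, each hop being one column operation. Closed
   configurations are counted by the sum of the principal minors of B, that is by det (1 + B), and B
   has the eigenvectors sin (j k pi / (n + 1)) with the odd entries rescaled by
   l = c + sqrt (1 + c^2), c = cos (k pi / (n + 1)), with eigenvalue l^m. *)

theory Submission
  imports Defs "Jordan_Normal_Form.Char_Poly"
begin

text \<open>No signs survive in the minors for the following reason. Time runs around the girth and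
  is cyclic, but the sites form an open path, so a closed history brings each particle back to its
  own site and contributes \<open>+1\<close> to a principal minor. Evenness of \<open>m\<close> lets
  the brick wall close up (columns \<open>c = 0\<close> and \<open>c = m\<close> have equal parity),
  lets the eigenvectors be tracked two columns at a time, and makes \<open>m\<close>-th powers blind
  to signs. The moves of a column, acting on vectors, add entries of one colour to neighbouring
  entries of the other colour. On a sine wave the sum over both neighbours is multiplication by
  \<open>2 cos t\<close>, so only the two amplitudes on even and odd sites change, and
  \<open>l - 1 / l = 2 cos t\<close> makes them an eigenvector. Only the positive root is taken for
  each \<open>k\<close>: the negative root for \<open>k\<close> gives the same vector as the
  positive root for \<open>n + 1 - k\<close>. Hence the count is a product of \<open>n\<close>
  single factors, and the square root in the theorem merely symmetrises it under this
  reflection.\<close>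

section \<open>Minors and column operations\<close>

definition leibniz_minor :: "(nat \<Rightarrow> nat \<Rightarrow> real) \<Rightarrow> nat set \<Rightarrow> (nat \<Rightarrow> nat) \<Rightarrow> real" where
  "leibniz_minor B P f = (\<Sum>p | p permutes P. of_int (sign p) * (\<Prod>x\<in>P. B (p x) (f x)))"

lemma leibniz_minor_cong:
  assumes "\<And>i x. i \<in> P \<Longrightarrow> x \<in> P \<Longrightarrow> B i (f x) = C i (g x)"
  shows "leibniz_minor B P f = leibniz_minor C P g"
  unfolding leibniz_minor_def
  by (intro sum.cong arg_cong2[where f = "(*)"] prod.cong refl assms)
     (auto simp: permutes_in_image)

text \<open>Composing with the transposition of \<open>x\<close> and \<open>y\<close> permutes the
  summands, keeps every product and reverses every sign, so the sum equals its own negative.\<close>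

lemma leibniz_minor_equal_columns:
  assumes "finite P" "x \<in> P" "y \<in> P" "x \<noteq> y" "f x = f y"
  shows "leibniz_minor B P f = 0"
proof -
  let ?t = "transpose x y"
  have t: "?t permutes P" using assms by (simp add: permutes_swap_id)
  have "leibniz_minor B P f =
      (\<Sum>p | p permutes P. of_int (sign (p \<circ> ?t)) * (\<Prod>z\<in>P. B ((p \<circ> ?t) z) (f z)))"
    unfolding leibniz_minor_def by (rule sum_permutations_compose_right[OF t])
  also have "\<dots> = (\<Sum>p | p permutes P. - (of_int (sign p) * (\<Prod>z\<in>P. B (p z) (f z))))"
  proof (intro sum.cong refl)
    fix p assume "p \<in> {p. p permutes P}"
    then have p: "permutation p" using assms(1) permutation_permutes by auto
    have s: "sign (p \<circ> ?t) = - sign p"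
      using p assms(4) by (simp add: sign_compose permutation_swap_id sign_swap_id)
    have "(\<Prod>z\<in>P. B ((p \<circ> ?t) z) (f z)) = (\<Prod>z\<in>P. B (p z) (f (?t z)))"
      by (subst prod.permute[OF t]) (simp add: o_def)
    also have "\<dots> = (\<Prod>z\<in>P. B (p z) (f z))"
      using assms(5) by (intro prod.cong refl) (auto simp: transpose_def)
    finally show "of_int (sign (p \<circ> ?t)) * (\<Prod>z\<in>P. B ((p \<circ> ?t) z) (f z)) =
        - (of_int (sign p) * (\<Prod>z\<in>P. B (p z) (f z)))"
      by (simp add: s)
  qed
  also have "\<dots> = - leibniz_minor B P f" by (simp add: leibniz_minor_def sum_negf)
  finally show ?thesis by simp
qed

text \<open>Linearity in one column; injectivity of \<open>f\<close> guarantees that only position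
  \<open>x\<close> sees the changed column \<open>b\<close>.\<close>

lemma leibniz_minor_add_column:
  assumes "finite P" "x \<in> P" "inj_on f P" "f x = b"
  shows "leibniz_minor (\<lambda>i j. if j = b then B i b + B i w else B i j) P f =
         leibniz_minor B P f + leibniz_minor B P (f(x := w))"
proof -
  let ?C = "\<lambda>i j. if j = b then B i b + B i w else B i j"
  have other: "f z \<noteq> b" if "z \<in> P - {x}" for z
    using that assms by (auto dest: inj_onD)
  have *: "(\<Prod>z\<in>P. ?C (p z) (f z)) =
      (\<Prod>z\<in>P. B (p z) (f z)) + (\<Prod>z\<in>P. B (p z) ((f(x := w)) z))" for p :: "nat \<Rightarrow> nat"
  proof -
    have "(\<Prod>z\<in>P - {x}. ?C (p z) (f z)) = (\<Prod>z\<in>P - {x}. B (p z) (f z))"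
      using other by (intro prod.cong refl) auto
    moreover have "(\<Prod>z\<in>P - {x}. B (p z) ((f(x := w)) z)) = (\<Prod>z\<in>P - {x}. B (p z) (f z))"
      by (intro prod.cong refl) auto
    ultimately show ?thesis
      using assms by (simp add: prod.remove[of P x] algebra_simps)
  qed
  show ?thesis
    unfolding leibniz_minor_def * by (simp add: sum.distrib distrib_left)
qed

section \<open>Sums of principal minors and eigenvalues\<close>

lemma prod_of_bool:
  "finite S \<Longrightarrow> (\<Prod>x\<in>S. of_bool (Q x)) = (of_bool (\<forall>x\<in>S. Q x) :: real)"
  by (induction S rule: finite_induct) auto

text \<open>Expanding each factor of the Leibniz sum for \<open>det (1 + B)\<close> chooses the set
  \<open>P\<close> of positions that take the entry of \<open>B\<close>; the identity forces the
  remaining positions to be fixed points.\<close>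

lemma sum_principal_minors:
  "(\<Sum>P\<in>Pow {..<n}. leibniz_minor B P id) =
   (\<Sum>p | p permutes {..<n}. of_int (sign p) * (\<Prod>x<n. of_bool (p x = x) + B (p x) x))"
proof -
  let ?N = "{..<n}"
  let ?f = "\<lambda>P p. of_int (sign p) * (\<Prod>x\<in>P. B (p x) x) :: real"
  have fin: "finite {p. p permutes ?N}" by (simp add: finite_permutations)
  have "(\<Sum>p | p permutes ?N. of_int (sign p) * (\<Prod>x<n. of_bool (p x = x) + B (p x) x)) =
      (\<Sum>p | p permutes ?N. \<Sum>P\<in>Pow ?N. ?f P p * of_bool (\<forall>x\<in>?N - P. p x = x))"
  proof (rule sum.cong[OF refl])
    fix p :: "nat \<Rightarrow> nat"
    have "(\<Prod>x<n. of_bool (p x = x) + B (p x) x) =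
        (\<Sum>P\<in>Pow ?N. (\<Prod>x\<in>P. B (p x) x) * (\<Prod>x\<in>?N - P. of_bool (p x = x)))"
      by (subst add.commute) (rule prod_add, simp)
    then show "of_int (sign p) * (\<Prod>x<n. of_bool (p x = x) + B (p x) x) =
        (\<Sum>P\<in>Pow ?N. ?f P p * of_bool (\<forall>x\<in>?N - P. p x = x))"
      by (simp only: sum_distrib_left prod_of_bool finite_Diff finite_lessThan mult.assoc)
  qed
  also have "\<dots> = (\<Sum>P\<in>Pow ?N. \<Sum>p | p permutes ?N. ?f P p * of_bool (\<forall>x\<in>?N - P. p x = x))"
    by (rule sum.swap)
  also have "\<dots> = (\<Sum>P\<in>Pow ?N. leibniz_minor B P id)"
  proof (rule sum.cong[OF refl])
    fix P assume "P \<in> Pow ?N"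
    then have P: "P \<subseteq> ?N" by simp
    have "(\<Sum>p | p permutes P. ?f P p * of_bool (\<forall>x\<in>?N - P. p x = x)) =
        (\<Sum>p | p permutes ?N. ?f P p * of_bool (\<forall>x\<in>?N - P. p x = x))"
    \<comment> \<open>A permutation that fixes everything outside \<open>P\<close> permutes
      \<open>P\<close>, so the indicator kills all other terms. The value of \<open>sign\<close>
      does not depend on the ambient set.\<close>
    proof (rule sum.mono_neutral_left[OF fin])
      show "{p. p permutes P} \<subseteq> {p. p permutes ?N}"
        using P permutes_subset by blast
      show "\<forall>p\<in>{p. p permutes ?N} - {p. p permutes P}.
          ?f P p * of_bool (\<forall>x\<in>?N - P. p x = x) = 0"
        using permutes_superset by auto
    qed
    moreover have "(\<Sum>p | p permutes P. ?f P p * of_bool (\<forall>x\<in>?N - P. p x = x)) =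
        leibniz_minor B P id"
      unfolding leibniz_minor_def by (intro sum.cong refl) (auto simp: permutes_not_in)
    ultimately show "(\<Sum>p | p permutes ?N. ?f P p * of_bool (\<forall>x\<in>?N - P. p x = x)) =
        leibniz_minor B P id" by simp
  qed
  finally show ?thesis by simp
qed

text \<open>With \<open>n\<close> distinct eigenvalues the characteristic polynomial is known
  completely, and one of its values is the determinant of \<open>1 + B\<close>.\<close>

lemma sum_principal_minors_eigenvalues:
  fixes B :: "nat \<Rightarrow> nat \<Rightarrow> real" and ev :: "nat \<Rightarrow> real" and v :: "nat \<Rightarrow> nat \<Rightarrow> real"
  assumes eig: "\<And>k i. k \<in> K \<Longrightarrow> i < n \<Longrightarrow> (\<Sum>j<n. B i j * v k j) = ev k * v k i"
    and nz: "\<And>k. k \<in> K \<Longrightarrow> \<exists>i<n. v k i \<noteq> 0"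
    and inj: "inj_on ev K" and K: "card K = n" "finite K"
  shows "(\<Sum>P\<in>Pow {..<n}. leibniz_minor B P id) = (\<Prod>k\<in>K. 1 + ev k)"
proof -
  \<comment> \<open>The sign is chosen so that the characteristic polynomial of \<open>A\<close> at
    \<open>0\<close> is \<open>det (1 + B)\<close>, free of a factor
    \<open>(-1) ^ n\<close>.\<close>
  define A where "A = mat n n (\<lambda>(i, j). - (of_bool (i = j) + B i j))"
  have A: "A \<in> carrier_mat n n" by (simp add: A_def)
  let ?q = "\<Prod>k\<in>K. [:1 + ev k, 1:]"
  have root: "poly (char_poly A) (- (1 + ev k)) = 0" if k: "k \<in> K" for k
  proof -
    have "eigenvector A (vec n (v k)) (- (1 + ev k))"
      unfolding eigenvector_def
    proof (intro conjI)
      show "vec n (v k) \<in> carrier_vec (dim_row A)" by (simp add: A_def)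
      obtain i where "i < n" "v k i \<noteq> 0" using nz[OF k] by blast
      then show "vec n (v k) \<noteq> 0\<^sub>v (dim_row A)"
        using A by (metis carrier_matD(1) index_vec index_zero_vec(1))
      show "A *\<^sub>v vec n (v k) = - (1 + ev k) \<cdot>\<^sub>v vec n (v k)"
      proof (rule eq_vecI)
        fix i assume "i < dim_vec (- (1 + ev k) \<cdot>\<^sub>v vec n (v k))"
        then have i: "i < n" by simp
        have "(A *\<^sub>v vec n (v k)) $ i = (\<Sum>j<n. - (of_bool (i = j) + B i j) * v k j)"
          using i by (simp add: A_def scalar_prod_def atLeast0LessThan)
        also have "\<dots> = - (\<Sum>j<n. if i = j then v k j else 0) - (\<Sum>j<n. B i j * v k j)"
          unfolding sum_negf[symmetric] sum_subtractf[symmetric]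
          by (intro sum.cong refl) (simp add: algebra_simps)
        also have "\<dots> = - (1 + ev k) * v k i"
          using i by (simp add: eig[OF k i] algebra_simps)
        finally show "(A *\<^sub>v vec n (v k)) $ i = (- (1 + ev k) \<cdot>\<^sub>v vec n (v k)) $ i"
          using i by simp
      qed (simp add: A_def)
    qed
    then show ?thesis
      using eigenvalue_root_char_poly[OF A] unfolding eigenvalue_def by blast
  qed
  have deg: "degree (char_poly A) = n" "monic (char_poly A)"
    using degree_monic_char_poly[OF A] by auto
  have dq: "degree ?q = n" using K by (subst degree_prod_eq_sum_degree) auto
  have "char_poly A = ?q"
  proof (rule poly_eqI_degree_lead_coeff)
    have "monic ?q" by (rule monic_prod) simp
    then show "coeff (char_poly A) n = coeff ?q n" using deg dq by simp
    \<comment> \<open>Both polynomials are monic of degree \<open>n\<close>, so agreement at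
      \<open>n\<close> different points suffices; distinctness of the eigenvalues supplies
      them.\<close>
    show "n \<le> card ((\<lambda>k. - (1 + ev k)) ` K)"
      using inj K by (subst card_image) (auto simp: inj_on_def)
    show "degree (char_poly A) \<le> n" "degree ?q \<le> n" using deg dq by simp_all
    fix z assume "z \<in> (\<lambda>k. - (1 + ev k)) ` K"
    then show "poly (char_poly A) z = poly ?q z"
      using root K by (auto simp: poly_prod)
  qed
  then have "(\<Prod>k\<in>K. 1 + ev k) = poly (char_poly A) 0" by (simp add: poly_prod)
  also have "\<dots> = det (- char_matrix A 0)" by (rule char_poly_matrix[OF A])
  also have "- char_matrix A 0 = mat n n (\<lambda>(i, j). of_bool (i = j) + B i j)"
    by (rule eq_matI) (auto simp: char_matrix_def A_def)
  also have "det \<dots> = (\<Sum>p | p permutes {..<n}.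
      of_int (sign p) * (\<Prod>x<n. of_bool (p x = x) + B (p x) x))"
    by (subst det_col[where n = n])
       (auto simp: atLeast0LessThan permutes_in_image intro!: sum.cong prod.cong)
  finally show ?thesis by (simp add: sum_principal_minors)
qed

text \<open>A move \<open>(w, b)\<close> is the elementary matrix adding column \<open>w\<close> to column \<open>b\<close>; in the particle
  picture it lets a particle hop from \<open>w\<close> to a vacant \<open>b\<close>. The head of a list is the last move.\<close>

fun move_matrix :: "(nat \<times> nat) list \<Rightarrow> nat \<Rightarrow> nat \<Rightarrow> real" where
  "move_matrix [] i j = of_bool (i = j)"
| "move_matrix ((w, b) # ms) i j =
     (if j = b then move_matrix ms i b + move_matrix ms i w else move_matrix ms i j)"

text \<open>The recursion undoes the last move: it was skipped, or the particle now at
  \<open>b\<close> came from \<open>w\<close>, which has to be vacant afterwards.\<close>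

fun num_walks :: "(nat \<times> nat) list \<Rightarrow> nat set \<Rightarrow> nat set \<Rightarrow> nat" where
  "num_walks [] P Q = of_bool (P = Q)"
| "num_walks ((w, b) # ms) P Q = num_walks ms P Q +
     (if b \<in> Q \<and> w \<notin> Q then num_walks ms P (insert w (Q - {b})) else 0)"

section \<open>Minors as numbers of walks\<close>

text \<open>In increasing order of \<open>x\<close>: smaller points are fixed, so by injectivity
  \<open>f\<close> cannot send \<open>x\<close> below itself; then neither a smaller nor a larger
  point can be mapped to \<open>x\<close>.\<close>

lemma strict_mono_on_self_image:
  fixes f :: "nat \<Rightarrow> nat"
  assumes "strict_mono_on P f" "f ` P = P" "finite P" "x \<in> P"
  shows "f x = x"
proof -
  have "f x = x" if "x \<in> P" "finite P" for x
    using that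
  proof (induction x rule: less_induct)
    case (less x)
    have inj: "inj_on f P" using assms(1) by (rule strict_mono_on_imp_inj_on)
    have "f x \<ge> x"
    proof (rule ccontr)
      assume "\<not> f x \<ge> x"
      then have l: "f x < x" by simp
      have "f x \<in> P" using less assms by auto
      then have "f (f x) = f x" using less l by blast
      then show False using inj \<open>f x \<in> P\<close> \<open>x \<in> P\<close> l by (metis inj_onD less_irrefl)
    qed
    obtain y where y: "y \<in> P" "f y = x" using less assms(2) by (metis imageE)
    have "\<not> y < x" using less y by (metis less_irrefl)
    moreover have "\<not> x < y" using y assms(1) \<open>f x \<ge> x\<close> less.prems
      by (metis leD strict_mono_onD)
    ultimately show ?case using y by (metis linorder_neqE_nat)
  qed
  then show ?thesis using assms by blast
qed

text \<open>A surviving permutation must agree with \<open>f\<close> on \<open>P\<close>.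
  Monotonicity then makes it the identity, whose sign is \<open>+1\<close>; this is where signs
  disappear.\<close>

lemma leibniz_minor_identity:
  assumes "finite P" "strict_mono_on P f"
  shows "leibniz_minor (\<lambda>i j. of_bool (i = j)) P f = of_bool (f ` P = P)"
proof (cases "f ` P = P")
  case True
  have "leibniz_minor (\<lambda>i j. of_bool (i = j)) P f =
      (\<Sum>p | p permutes P. if p = id then 1 else 0)"
    unfolding leibniz_minor_def
  proof (intro sum.cong refl)
    fix p assume "p \<in> {p. p permutes P}"
    then have p: "p permutes P" by simp
    have f: "f x = x" if "x \<in> P" for x
      using strict_mono_on_self_image[OF assms(2) True assms(1) that] .
    have "(\<Prod>x\<in>P. of_bool (p x = f x)) = (of_bool (\<forall>x\<in>P. p x = f x) :: real)"
      using assms by (simp add: prod_of_bool)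
    moreover have "(\<forall>x\<in>P. p x = f x) \<longleftrightarrow> p = id"
      using f permutes_not_in[OF p] by (fastforce simp: fun_eq_iff)
    ultimately show "of_int (sign p) * (\<Prod>x\<in>P. of_bool (p x = f x)) = (if p = id then 1 else (0::real))"
      by (simp add: sign_id)
  qed
  also have "\<dots> = 1" using assms by (simp add: finite_permutations)
  finally show ?thesis using True by simp
next
  case False
  have "(\<Prod>x\<in>P. of_bool (p x = f x)) = (0::real)" if "p permutes P" for p
  proof -
    have "\<exists>x\<in>P. p x \<noteq> f x"
    proof (rule ccontr)
      assume "\<not> ?thesis"
      then have "f ` P = p ` P" by (intro image_cong) auto
      then show False using False permutes_image[OF that] by simp
    qed
    then show ?thesis using assms by (simp add: prod_zero_iff)
  qed
  then show ?thesis using False by (simp add: leibniz_minor_def)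
qed

text \<open>No site lies strictly between \<open>b\<close> and \<open>w\<close>, so no other
  particle can be overtaken.\<close>

lemma strict_mono_on_hop:
  fixes f :: "nat \<Rightarrow> nat"
  assumes "strict_mono_on P f" "x \<in> P" "f x = b" "w \<notin> f ` P" "w = Suc b \<or> b = Suc w"
  shows "strict_mono_on P (f(x := w))"
proof (rule strict_mono_onI)
  fix r s assume rs: "r \<in> P" "s \<in> P" "r < s"
  then have l: "f r < f s" using assms(1) by (simp add: strict_mono_onD)
  have "f r \<noteq> w" "f s \<noteq> w" using assms rs by auto
  then show "(f(x := w)) r < (f(x := w)) s"
    using l assms rs by auto
qed

text \<open>A Lindstroem-Gessel-Viennot argument carried out move by move: linearity in column
  \<open>b\<close> reproduces the two alternatives of \<open>num_walks\<close>, and adjacency keeps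
  the column list increasing.\<close>

lemma leibniz_minor_move_matrix:
  assumes "finite P" "strict_mono_on P f" "\<forall>(w, b) \<in> set ms. w = Suc b \<or> b = Suc w"
  shows "leibniz_minor (move_matrix ms) P f = real (num_walks ms P (f ` P))"
  using assms(2,3)
proof (induction ms arbitrary: f)
  case Nil
  have "move_matrix [] = (\<lambda>i j. of_bool (i = j))" by (intro ext) simp
  then show ?case using leibniz_minor_identity[OF assms(1) Nil(1)] by auto
next
  case (Cons mv ms)
  obtain w b where mv: "mv = (w, b)" by (cases mv)
  have adj: "w = Suc b \<or> b = Suc w" using Cons.prems mv by auto
  have IH: "leibniz_minor (move_matrix ms) P g = real (num_walks ms P (g ` P))"
    if "strict_mono_on P g" for g
    using Cons that by simp
  have inj: "inj_on f P" using Cons.prems(1) by (rule strict_mono_on_imp_inj_on)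
  have M: "move_matrix (mv # ms) =
      (\<lambda>i j. if j = b then move_matrix ms i b + move_matrix ms i w else move_matrix ms i j)"
    by (intro ext) (simp add: mv)
  show ?case
  proof (cases "b \<in> f ` P")
    case False
    then have "leibniz_minor (move_matrix (mv # ms)) P f = leibniz_minor (move_matrix ms) P f"
      unfolding M by (intro leibniz_minor_cong) auto
    then show ?thesis
      using False IH[OF Cons.prems(1)] by (simp only: mv num_walks.simps) simp
  next
    case True
    then obtain x where x: "x \<in> P" "f x = b" by auto
    have img: "(f(x := w)) ` P = insert w (f ` P - {b})"
      using x inj by (auto simp: inj_on_def)
    have "leibniz_minor (move_matrix (mv # ms)) P f =
        leibniz_minor (move_matrix ms) P f + leibniz_minor (move_matrix ms) P (f(x := w))"
      unfolding M using leibniz_minor_add_column[OF assms(1) x(1) inj x(2)] .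
    \<comment> \<open>A hop out of an occupied configuration at \<open>w\<close> would need two
      particles there beforehand. In the minor this is a repeated column.\<close>
    moreover have "leibniz_minor (move_matrix ms) P (f(x := w)) = 0" if "w \<in> f ` P"
    proof -
      from that obtain y where y: "y \<in> P" "f y = w" by auto
      then have "x \<noteq> y" using x adj by auto
      then show ?thesis
        using leibniz_minor_equal_columns[OF assms(1) x(1) y(1), of "f(x := w)"] y by simp
    qed
    moreover have "leibniz_minor (move_matrix ms) P (f(x := w)) =
        real (num_walks ms P (insert w (f ` P - {b})))" if "w \<notin> f ` P"
      using IH[OF strict_mono_on_hop[OF Cons.prems(1) x that adj]] img by simp
    ultimately show ?thesis
      using True IH[OF Cons.prems(1)] by (simp add: mv del: move_matrix.simps)
  qed
qed

lemma sum_closed_walks: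
  assumes "\<forall>(w, b) \<in> set ms. w = Suc b \<or> b = Suc w"
  shows "real (\<Sum>P\<in>Pow {..<n}. num_walks ms P P) =
    (\<Sum>P\<in>Pow {..<n}. leibniz_minor (move_matrix ms) P id)"
  unfolding of_nat_sum
proof (intro sum.cong refl)
  fix P :: "nat set" assume "P \<in> Pow {..<n}"
  then have "finite P" by (auto intro: finite_subset)
  then show "real (num_walks ms P P) = leibniz_minor (move_matrix ms) P id"
    using leibniz_minor_move_matrix[of P id ms] assms by (simp add: strict_mono_on_def)
qed

section \<open>Action of the moves on vectors\<close>

text \<open>Column operations multiply from the right, so on a vector the head of the list acts
  first, and entry \<open>w\<close> receives entry \<open>b\<close> although the particle hops from
  \<open>w\<close> to \<open>b\<close>.\<close>

fun move_apply :: "(nat \<times> nat) list \<Rightarrow> (nat \<Rightarrow> real) \<Rightarrow> nat \<Rightarrow> real" where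
  "move_apply [] x = x"
| "move_apply ((w, b) # ms) x = move_apply ms (x(w := x w + x b))"

lemma move_matrix_mult:
  assumes "\<forall>(w, b) \<in> set ms. w < n \<and> b < n \<and> w \<noteq> b" "i < n"
  shows "(\<Sum>j<n. move_matrix ms i j * x j) = move_apply ms x i"
  using assms(1)
proof (induction ms arbitrary: x)
  case Nil
  have "(\<Sum>j<n. move_matrix [] i j * x j) = (\<Sum>j<n. if i = j then x j else 0)"
    by (intro sum.cong refl) simp
  then show ?case using assms(2) by simp
next
  case (Cons mv ms)
  obtain w b where mv: "mv = (w, b)" by (cases mv)
  have wb: "w < n" "b < n" "w \<noteq> b" using Cons.prems mv by auto
  let ?M = "move_matrix ms i"
  have "(\<Sum>j<n. move_matrix (mv # ms) i j * x j) =
      (\<Sum>j<n. ?M j * x j) + (\<Sum>j<n. if j = b then ?M w * x j else 0)"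
    unfolding sum.distrib[symmetric] mv by (intro sum.cong refl) (simp add: algebra_simps)
  also have "\<dots> = (\<Sum>j<n. ?M j * x j) + (\<Sum>j<n. if j = w then ?M j * x b else 0)"
    using wb by simp
  also have "\<dots> = (\<Sum>j<n. ?M j * (x(w := x w + x b)) j)"
    unfolding sum.distrib[symmetric] by (intro sum.cong refl) (simp add: algebra_simps)
  also have "\<dots> = move_apply ms (x(w := x w + x b)) i"
    using Cons.IH Cons.prems by (simp add: fun_upd_def)
  finally show ?case by (simp add: mv)
qed

section \<open>Hopping particles\<close>

text \<open>White means \<open>i + j\<close> odd. Every move of column \<open>i\<close> leads from
  white to black, so no target is a source: the elementary matrices of one column commute and a
  particle hops at most once per column.\<close>

definition edge_move :: "nat \<Rightarrow> nat \<Rightarrow> nat \<times> nat" where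
  "edge_move i r = (if odd (i + r) then (r, Suc r) else (Suc r, r))"

primrec column_moves :: "nat \<Rightarrow> nat \<Rightarrow> (nat \<times> nat) list" where
  "column_moves i 0 = []"
| "column_moves i (Suc r) = edge_move i r # column_moves i r"

primrec cylinder_moves :: "nat \<Rightarrow> nat \<Rightarrow> (nat \<times> nat) list" where
  "cylinder_moves n 0 = []"
| "cylinder_moves n (Suc k) = column_moves k (n - 1) @ cylinder_moves n k"

lemma column_moves_adjacent:
  "(w, b) \<in> set (column_moves i r) \<Longrightarrow> w \<le> r \<and> b \<le> r \<and> (w = Suc b \<or> b = Suc w)"
proof (induction r)
  case (Suc r)
  then consider "(w, b) = edge_move i r" | "(w, b) \<in> set (column_moves i r)" by auto
  then show ?case
  proof cases
    case 1
    then show ?thesis by (simp add: edge_move_def split: if_splits)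
  next
    case 2
    then show ?thesis using Suc.IH by simp
  qed
qed simp

lemma cylinder_moves_adjacent:
  assumes "n \<ge> 1" "(w, b) \<in> set (cylinder_moves n k)"
  shows "w < n \<and> b < n \<and> (w = Suc b \<or> b = Suc w)"
  using assms(2)
proof (induction k)
  case (Suc k)
  then consider "(w, b) \<in> set (column_moves k (n - 1))" | "(w, b) \<in> set (cylinder_moves n k)"
    by auto
  then show ?case
  proof cases
    case 1
    show ?thesis using column_moves_adjacent[OF 1] assms(1) by linarith
  next
    case 2
    then show ?thesis by (rule Suc.IH)
  qed
qed simp

section \<open>One column: vertical edges against hops\<close>

text \<open>Index \<open>r\<close> stands for the edge from site \<open>r\<close> to
  \<open>Suc r\<close>. The test \<open>0 < j\<close> keeps truncated subtraction from counting edge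
  \<open>0\<close> twice at site \<open>0\<close>.\<close>

definition vertical_degree :: "nat set \<Rightarrow> nat \<Rightarrow> nat" where
  "vertical_degree V j = of_bool (j \<in> V) + of_bool (0 < j \<and> j - 1 \<in> V)"

text \<open>Particle conservation from \<open>P\<close> to \<open>Q\<close>: a particle at a white
  site stays or leaves through one edge of \<open>V\<close>, and a black site is filled by at most
  one particle. Stated with numbers in \<open>nat\<close>, it excludes double use by itself.\<close>

definition compatible :: "nat \<Rightarrow> nat set \<Rightarrow> nat set \<Rightarrow> nat set \<Rightarrow> bool" where
  "compatible i P V Q \<longleftrightarrow> (\<forall>j.
     if odd (i + j) then of_bool (j \<in> P) = of_bool (j \<in> Q) + vertical_degree V j
     else of_bool (j \<in> Q) = of_bool (j \<in> P) + vertical_degree V j)"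

lemma compatible_empty: "compatible i P {} Q \<longleftrightarrow> P = Q"
  by (auto simp: compatible_def vertical_degree_def)

lemma vertical_degree_insert:
  assumes "V \<subseteq> {..<r}"
  shows "vertical_degree (insert r V) j = vertical_degree V j + of_bool (j = r \<or> j = Suc r)"
proof -
  have "r \<notin> V" "Suc r \<notin> V" using assms by auto
  moreover have "0 < j \<and> j - 1 = r \<longleftrightarrow> j = Suc r" by arith
  ultimately show ?thesis
    by (cases "j = r"; cases "j = Suc r") (auto simp: vertical_degree_def)
qed

text \<open>An additional edge raises the degree by one exactly at its ends; this is absorbed by
  moving the particle at \<open>b\<close> back to \<open>w\<close>.\<close>

lemma compatible_insert:
  assumes V: "V \<subseteq> {..<r}" and mv: "edge_move i r = (w, b)"
  shows "compatible i P (insert r V) Q \<longleftrightarrow>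
    b \<in> Q \<and> w \<notin> Q \<and> compatible i P V (insert w (Q - {b}))"
proof -
  have wb: "w \<noteq> b" "odd (i + w)" "even (i + b)"
    using mv by (auto simp: edge_move_def split: if_splits)
  have ends: "j = w \<or> j = b \<longleftrightarrow> j = r \<or> j = Suc r" for j
    using mv by (auto simp: edge_move_def split: if_splits)
  have deg: "vertical_degree (insert r V) j = vertical_degree V j + of_bool (j = w \<or> j = b)" for j
    unfolding ends by (rule vertical_degree_insert[OF V])
  let ?L = "\<lambda>j. if odd (i + j)
      then of_bool (j \<in> P) = of_bool (j \<in> Q) + vertical_degree (insert r V) j
      else of_bool (j \<in> Q) = of_bool (j \<in> P) + vertical_degree (insert r V) j"
  let ?Q = "insert w (Q - {b})"
  let ?R = "\<lambda>j. if odd (i + j)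
      then of_bool (j \<in> P) = of_bool (j \<in> ?Q) + vertical_degree V j
      else of_bool (j \<in> ?Q) = of_bool (j \<in> P) + vertical_degree V j"
  have other: "?L j \<longleftrightarrow> ?R j" if "j \<noteq> w" "j \<noteq> b" for j
    using that by (simp add: deg)
  have w: "?L w \<longleftrightarrow> w \<notin> Q \<and> ?R w"
    using wb by (cases "w \<in> P"; cases "w \<in> Q") (simp_all add: deg)
  have b: "?L b \<longleftrightarrow> b \<in> Q \<and> ?R b"
    using wb by (cases "b \<in> P"; cases "b \<in> Q") (simp_all add: deg)
  have "(\<forall>j. ?L j) \<longleftrightarrow> b \<in> Q \<and> w \<notin> Q \<and> (\<forall>j. ?R j)"
  proof
    assume L: "\<forall>j. ?L j"
    have "?R j" for j
    proof (cases "j = w \<or> j = b")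
      case True
      then show ?thesis using w b L by metis
    next
      case False
      then show ?thesis using other[of j] L[rule_format, of j] by blast
    qed
    then show "b \<in> Q \<and> w \<notin> Q \<and> (\<forall>j. ?R j)"
      using w b L by blast
  next
    assume R: "b \<in> Q \<and> w \<notin> Q \<and> (\<forall>j. ?R j)"
    show "\<forall>j. ?L j"
    proof
      fix j
      have Rj: "?R j" using R by blast
      consider "j = w" | "j = b" | "j \<noteq> w" "j \<noteq> b" by blast
      then show "?L j"
      proof cases
        case 1
        show ?thesis unfolding 1 w using R Rj unfolding 1 by blast
      next
        case 2
        show ?thesis unfolding 2 b using R Rj unfolding 2 by blast
      next
        case 3
        then show ?thesis using other[of j] Rj by blast
      qed
    qed
  qed
  then show ?thesis unfolding compatible_def .
qed

text \<open>Splitting by \<open>r \<in> V\<close> gives the same recursion as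
  \<open>num_walks\<close> for one more move.\<close>

lemma card_compatible_Suc:
  assumes mv: "edge_move i r = (w, b)"
  shows "card {V. V \<subseteq> {..<Suc r} \<and> compatible i P V Q} =
    card {V. V \<subseteq> {..<r} \<and> compatible i P V Q} +
    (if b \<in> Q \<and> w \<notin> Q
     then card {V. V \<subseteq> {..<r} \<and> compatible i P V (insert w (Q - {b}))} else 0)"
proof -
  let ?A = "{V. V \<subseteq> {..<r} \<and> compatible i P V Q}"
  let ?B = "{V. V \<subseteq> {..<r} \<and> compatible i P (insert r V) Q}"
  have "{V. V \<subseteq> {..<Suc r} \<and> compatible i P V Q} = ?A \<union> insert r ` ?B"
  proof (rule equalityI; rule subsetI)
    fix V assume V: "V \<in> {V. V \<subseteq> {..<Suc r} \<and> compatible i P V Q}"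
    show "V \<in> ?A \<union> insert r ` ?B"
    proof (cases "r \<in> V")
      case True
      then have "V = insert r (V - {r})" by auto
      moreover have "V - {r} \<subseteq> {..<r}" using V by (auto simp: less_Suc_eq)
      ultimately show ?thesis using V by (intro UnI2 image_eqI[of _ _ "V - {r}"]) auto
    next
      case False
      then have "V \<subseteq> {..<r}" using V by (auto simp: less_Suc_eq)
      then show ?thesis using V by auto
    qed
  qed (auto simp: less_Suc_eq)
  moreover have "finite ?A" "finite ?B" by (auto intro: finite_subset[of _ "Pow {..<r}"])
  moreover have "?A \<inter> insert r ` ?B = {}" by auto
  moreover have "inj_on (insert r) ?B" by (auto simp: inj_on_def)
  ultimately have "card {V. V \<subseteq> {..<Suc r} \<and> compatible i P V Q} = card ?A + card ?B"
    by (simp add: card_Un_disjoint card_image)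
  moreover have "?B = (if b \<in> Q \<and> w \<notin> Q
      then {V. V \<subseteq> {..<r} \<and> compatible i P V (insert w (Q - {b}))} else {})"
    using compatible_insert[OF _ mv] by auto
  ultimately show ?thesis by simp
qed

text \<open>\<open>R\<close> is the position before the column and \<open>V\<close> the set of moves
  used in it, so the cardinality is an entry of the transfer matrix of one column.\<close>

lemma num_walks_column:
  assumes "Q \<subseteq> {..<n}" "r < n"
  shows "num_walks (column_moves i r @ ms) P Q =
    (\<Sum>R\<in>Pow {..<n}. num_walks ms P R * card {V. V \<subseteq> {..<r} \<and> compatible i R V Q})"
  using assms
proof (induction r arbitrary: Q)
  case 0
  have "card {V. V \<subseteq> {..<0::nat} \<and> compatible i R V Q} = of_bool (R = Q)" for R
  proof -
    have "{V. V \<subseteq> {..<0::nat} \<and> compatible i R V Q} = (if R = Q then {{}} else {})"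
      using compatible_empty by auto
    then show ?thesis by simp
  qed
  then have "(\<Sum>R\<in>Pow {..<n}. num_walks ms P R * card {V. V \<subseteq> {..<0::nat} \<and> compatible i R V Q}) =
      (\<Sum>R\<in>Pow {..<n}. if R = Q then num_walks ms P R else 0)"
    by (intro sum.cong refl) simp
  then show ?case using 0 by simp
next
  case (Suc r)
  obtain w b where mv: "edge_move i r = (w, b)" by (cases "edge_move i r")
  have "w < n" using mv Suc.prems by (auto simp: edge_move_def split: if_splits)
  then have Q': "insert w (Q - {b}) \<subseteq> {..<n}" using Suc.prems by auto
  have r: "r < n" using Suc.prems(2) by simp
  show ?case
    unfolding column_moves.simps append_Cons mv num_walks.simps card_compatible_Suc[OF mv]
      distrib_left sum.distrib Suc.IH[OF Suc.prems(1) r] Suc.IH[OF Q' r]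
    by (rule arg_cong2[where f = "(+)", OF refl]) (cases "b \<in> Q \<and> w \<notin> Q"; simp only: if_True if_False; simp)
qed

section \<open>Configurations on the cut cylinder\<close>

text \<open>The cylinder is cut along the wrap edges, which therefore occur as both column
  \<open>0\<close> and column \<open>m\<close> of \<open>H\<close>; taking \<open>P = Q\<close>
  glues them again.\<close>

definition configurations :: "nat \<Rightarrow> nat \<Rightarrow> nat set \<Rightarrow> nat set \<Rightarrow> ((nat \<times> nat) set \<times> (nat \<times> nat) set) set"
  where "configurations n m P Q = {(H, V). H \<subseteq> {..m} \<times> {..<n} \<and> V \<subseteq> {..<m} \<times> {..<n - 1} \<and>
     H `` {0} = P \<and> H `` {m} = Q \<and> (\<forall>i<m. compatible i (H `` {i}) (V `` {i}) (H `` {Suc i}))}"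

lemma finite_configurations: "finite (configurations n m P Q)"
  by (rule finite_subset[of _ "Pow ({..m} \<times> {..<n}) \<times> Pow ({..<m} \<times> {..<n - 1})"])
     (auto simp: configurations_def)

lemma configurations_0:
  assumes "P \<subseteq> {..<n}"
  shows "configurations n 0 P Q = (if P = Q then {({0} \<times> P, {})} else {})"
proof (rule equalityI; rule subsetI)
  fix a assume a: "a \<in> configurations n 0 P Q"
  obtain H V where HV: "a = (H, V)" by (cases a)
  have "H \<subseteq> {0} \<times> {..<n}" "V = {}" "H `` {0} = P" "P = Q"
    using a HV by (auto simp: configurations_def)
  then have "H = {0} \<times> P" by auto
  then show "a \<in> (if P = Q then {({0} \<times> P, {})} else {})"
    using HV \<open>V = {}\<close> \<open>P = Q\<close> by simp
next
  fix a :: "(nat \<times> nat) set \<times> (nat \<times> nat) set"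
  assume a: "a \<in> (if P = Q then {({0} \<times> P, {})} else {})"
  have "({0} \<times> P) `` {0} = P" by auto
  then show "a \<in> configurations n 0 P Q"
    using a assms by (auto simp: configurations_def split: if_splits)
qed

text \<open>Cutting off the last column leaves a shorter configuration ending in some
  \<open>R\<close>, and a free choice of compatible vertical edges.\<close>

lemma card_configurations_Suc:
  assumes Q: "Q \<subseteq> {..<n}"
  shows "card (configurations n (Suc m) P Q) =
    (\<Sum>R\<in>Pow {..<n}. card (configurations n m P R) *
       card {U. U \<subseteq> {..<n - 1} \<and> compatible m R U Q})"
proof -
  let ?S = "SIGMA R:Pow {..<n}. configurations n m P R \<times> {U. U \<subseteq> {..<n - 1} \<and> compatible m R U Q}"
  let ?f = "\<lambda>(H, V). (H `` {m}, (H \<inter> {..m} \<times> UNIV, V \<inter> {..<m} \<times> UNIV), V `` {m})"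
  let ?g = "\<lambda>(R :: nat set, (H, V), U). (H \<union> {Suc m} \<times> Q, V \<union> {m} \<times> U)"
  have "bij_betw ?f (configurations n (Suc m) P Q) ?S"
  proof (rule bij_betw_byWitness[where f' = ?g])
    show "\<forall>a\<in>configurations n (Suc m) P Q. ?g (?f a) = a"
    proof
      fix a assume a: "a \<in> configurations n (Suc m) P Q"
      obtain H V where HV: "a = (H, V)" by (cases a)
      have H: "H \<subseteq> {..Suc m} \<times> {..<n}" "V \<subseteq> {..<Suc m} \<times> {..<n - 1}" "H `` {Suc m} = Q"
        using a HV by (auto simp: configurations_def)
      have "H = H \<inter> {..m} \<times> UNIV \<union> {Suc m} \<times> Q"
        using H by (auto simp: le_Suc_eq)
      moreover have "V = V \<inter> {..<m} \<times> UNIV \<union> {m} \<times> V `` {m}"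
        using H by (auto simp: less_Suc_eq)
      ultimately show "?g (?f a) = a" by (simp add: HV)
    qed
    show "\<forall>a\<in>?S. ?f (?g a) = a"
    proof
      fix a assume a: "a \<in> ?S"
      obtain R H V U where HV: "a = (R, (H, V), U)" by (metis prod.exhaust)
      have H: "H \<subseteq> {..m} \<times> {..<n}" "V \<subseteq> {..<m} \<times> {..<n - 1}" "H `` {m} = R"
        using a HV by (auto simp: configurations_def)
      have "(H \<union> {Suc m} \<times> Q) `` {m} = R" using H by auto
      moreover have "(H \<union> {Suc m} \<times> Q) \<inter> {..m} \<times> UNIV = H" using H by auto
      moreover have "(V \<union> {m} \<times> U) \<inter> {..<m} \<times> UNIV = V" using H by auto
      moreover have "(V \<union> {m} \<times> U) `` {m} = U" using H by auto
      ultimately show "?f (?g a) = a" by (simp add: HV)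
    qed
    show "?f ` configurations n (Suc m) P Q \<subseteq> ?S"
    proof (rule image_subsetI)
      fix a assume a: "a \<in> configurations n (Suc m) P Q"
      obtain H V where HV: "a = (H, V)" by (cases a)
      have H: "H \<subseteq> {..Suc m} \<times> {..<n}" "V \<subseteq> {..<Suc m} \<times> {..<n - 1}" "H `` {0} = P"
        "H `` {Suc m} = Q"
        "\<And>i. i < Suc m \<Longrightarrow> compatible i (H `` {i}) (V `` {i}) (H `` {Suc i})"
        using a HV by (auto simp: configurations_def)
      have 1: "(H \<inter> {..m} \<times> UNIV) `` {i} = H `` {i}" if "i \<le> m" for i using that by auto
      have 2: "(V \<inter> {..<m} \<times> UNIV) `` {i} = V `` {i}" if "i < m" for i using that by auto
      have "(H \<inter> {..m} \<times> UNIV, V \<inter> {..<m} \<times> UNIV) \<in> configurations n m P (H `` {m})"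
        using H by (auto simp: configurations_def 1 2)
      then show "?f a \<in> ?S" using H by (auto simp: HV)
    qed
    show "?g ` ?S \<subseteq> configurations n (Suc m) P Q"
    proof (rule image_subsetI)
      fix a assume a: "a \<in> ?S"
      obtain R H V U where HV: "a = (R, (H, V), U)" by (metis prod.exhaust)
      have H: "H \<subseteq> {..m} \<times> {..<n}" "V \<subseteq> {..<m} \<times> {..<n - 1}" "H `` {0} = P" "H `` {m} = R"
        "\<And>i. i < m \<Longrightarrow> compatible i (H `` {i}) (V `` {i}) (H `` {Suc i})"
        "U \<subseteq> {..<n - 1}" "compatible m R U Q"
        using a HV by (auto simp: configurations_def)
      have 1: "(H \<union> {Suc m} \<times> Q) `` {i} = H `` {i}" if "i \<le> m" for i using that by auto
      have 2: "(V \<union> {m} \<times> U) `` {i} = V `` {i}" if "i < m" for i using that by auto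
      have 3: "(V \<union> {m} \<times> U) `` {m} = U" "(H \<union> {Suc m} \<times> Q) `` {Suc m} = Q" using H by auto
      have "H \<union> {Suc m} \<times> Q \<subseteq> {..Suc m} \<times> {..<n}" "V \<union> {m} \<times> U \<subseteq> {..<Suc m} \<times> {..<n - 1}"
        using H Q by (auto simp: le_Suc_eq less_Suc_eq)
      moreover have "compatible i ((H \<union> {Suc m} \<times> Q) `` {i}) ((V \<union> {m} \<times> U) `` {i})
          ((H \<union> {Suc m} \<times> Q) `` {Suc i})" if "i < Suc m" for i
      proof (cases "i = m")
        case True
        then show ?thesis using H 1[of m] 3 by simp
      next
        case False
        then have "i < m" using that by simp
        then show ?thesis using H 1[of i] 1[of "Suc i"] 2[of i] by simp
      qed
      ultimately show "?g a \<in> configurations n (Suc m) P Q"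
        using H 1[of 0] 3 by (simp add: HV configurations_def)
    qed
  qed
  then have "card (configurations n (Suc m) P Q) = card ?S" by (rule bij_betw_same_card)
  also have "\<dots> = (\<Sum>R\<in>Pow {..<n}. card (configurations n m P R \<times>
      {U. U \<subseteq> {..<n - 1} \<and> compatible m R U Q}))"
  proof (rule card_SigmaI)
    have "finite {U. U \<subseteq> {..<n - 1} \<and> compatible m R U Q}" for R
      by (rule finite_subset[of _ "Pow {..<n - 1}"]) auto
    then show "\<forall>R\<in>Pow {..<n}. finite (configurations n m P R \<times>
        {U. U \<subseteq> {..<n - 1} \<and> compatible m R U Q})"
      by (intro ballI finite_cartesian_product finite_configurations)
  qed simp
  finally show ?thesis by (simp add: card_cartesian_product)
qed

lemma num_walks_cylinder:
  assumes "n \<ge> 1" "P \<subseteq> {..<n}" "Q \<subseteq> {..<n}"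
  shows "num_walks (cylinder_moves n m) P Q = card (configurations n m P Q)"
  using assms(3)
proof (induction m arbitrary: Q)
  case 0
  then show ?case using configurations_0[OF assms(2)] by simp
next
  case (Suc m)
  have "num_walks (cylinder_moves n (Suc m)) P Q = (\<Sum>R\<in>Pow {..<n}.
      num_walks (cylinder_moves n m) P R * card {U. U \<subseteq> {..<n - 1} \<and> compatible m R U Q})"
    using num_walks_column[OF Suc.prems, of "n - 1"] assms(1) by simp
  also have "\<dots> = card (configurations n (Suc m) P Q)"
    unfolding card_configurations_Suc[OF Suc.prems]
    by (intro sum.cong refl) (simp add: Suc.IH)
  finally show ?case .
qed

section \<open>Matchings of the cylinder\<close>

text \<open>Index \<open>c\<close> is the edge on the left of column \<open>c\<close>, so column
  \<open>i\<close> lies between the edges \<open>i\<close> and \<open>Suc i\<close>. Both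
  \<open>0\<close> and \<open>m\<close> name the wrap edge, which avoids indices modulo
  \<open>m\<close>.\<close>

definition horizontal_edge :: "nat \<Rightarrow> nat \<Rightarrow> nat \<Rightarrow> cylinder_edge" where
  "horizontal_edge m c j =
     (if c = 0 \<or> c = m then Wrap (int j) else Grid {(int c - 1, int j), (int c, int j)})"

definition vertical_edge :: "nat \<Rightarrow> nat \<Rightarrow> cylinder_edge" where
  "vertical_edge i j = Grid {(int i, int j), (int i, int j + 1)}"

lemma horizontal_edge_inject:
  "c < m \<Longrightarrow> c' < m \<Longrightarrow> horizontal_edge m c j = horizontal_edge m c' j' \<longleftrightarrow> c = c' \<and> j = j'"
  by (auto simp: horizontal_edge_def doubleton_eq_iff)

text \<open>For \<open>m = 2\<close> the two edges have the same ends and differ only in their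
  constructors; for \<open>m = 1\<close> both would be the wrap edge.\<close>

lemma horizontal_edge_neq_Suc:
  "m \<ge> 2 \<Longrightarrow> i < m \<Longrightarrow> horizontal_edge m i j \<noteq> horizontal_edge m (Suc i) j"
  by (auto simp: horizontal_edge_def doubleton_eq_iff)

lemma vertical_edge_inject: "vertical_edge i j = vertical_edge i' j' \<longleftrightarrow> i = i' \<and> j = j'"
  by (auto simp: vertical_edge_def doubleton_eq_iff)

lemma horizontal_neq_vertical: "horizontal_edge m c j \<noteq> vertical_edge i k"
  by (auto simp: horizontal_edge_def vertical_edge_def doubleton_eq_iff)

section \<open>The edges of the cylinder in coordinates\<close>

lemma dist_int_pair_eq_1:
  shows "dist (real_of_int a, real_of_int b) (real_of_int c, real_of_int d) = 1 \<longleftrightarrow> (a = c \<and> \<bar>b - d\<bar> = 1) \<or> (\<bar>a - c\<bar> = 1 \<and> b = d)"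
proof -
  have sq: "x\<^sup>2 + y\<^sup>2 = 1 \<longleftrightarrow> (x = 0 \<and> \<bar>y\<bar> = 1) \<or> (\<bar>x\<bar> = 1 \<and> y = 0)" for x y :: int
  proof
    assume eq: "x\<^sup>2 + y\<^sup>2 = 1"
    have "x = 0 \<or> y = 0"
    proof (rule ccontr)
      assume "\<not> (x = 0 \<or> y = 0)"
      then have "x\<^sup>2 > 0" "y\<^sup>2 > 0" by simp_all
      then show False using eq by linarith
    qed
    then show "(x = 0 \<and> \<bar>y\<bar> = 1) \<or> (\<bar>x\<bar> = 1 \<and> y = 0)"
      using eq by (auto simp: power2_eq_1_iff)
  next
    assume "(x = 0 \<and> \<bar>y\<bar> = 1) \<or> (\<bar>x\<bar> = 1 \<and> y = 0)"
    then show "x\<^sup>2 + y\<^sup>2 = 1" by (auto simp: abs_if split: if_splits)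
  qed
  have "dist (real_of_int a, real_of_int b) (real_of_int c, real_of_int d) = sqrt (of_int ((a - c)\<^sup>2 + (b - d)\<^sup>2))"
    by (simp add: dist_prod_def dist_real_def)
  then have "dist (real_of_int a, real_of_int b) (real_of_int c, real_of_int d) = 1 \<longleftrightarrow> (of_int ((a - c)\<^sup>2 + (b - d)\<^sup>2) :: real) = of_int 1"
    by (simp only: real_sqrt_eq_1_iff of_int_1)
  also have "\<dots> \<longleftrightarrow> (a - c)\<^sup>2 + (b - d)\<^sup>2 = 1" by (rule of_int_eq_iff)
  finally show ?thesis unfolding sq by auto
qed

text \<open>The index \<open>c = m\<close> is left out on the right so that each wrap edge is named
  once.\<close>

lemma edges_cylinder:
  assumes "m \<ge> 1"
  shows "edges (cylinder m n) = {horizontal_edge m c j | c j. c < m \<and> j < n} \<union>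
    {vertical_edge i j | i j. i < m \<and> Suc j < n}" (is "_ = ?H \<union> ?V")
proof -
  have "Wrap ` {0..int n - 1} = {horizontal_edge m c j | c j. c = 0 \<and> j < n}"
  proof (rule equalityI; rule subsetI)
    fix e assume "e \<in> Wrap ` {0..int n - 1}"
    then obtain j where j: "0 \<le> j" "j \<le> int n - 1" "e = Wrap j" by auto
    then have "e = horizontal_edge m 0 (nat j)" "nat j < n" by (auto simp: horizontal_edge_def)
    then show "e \<in> {horizontal_edge m c j | c j. c = 0 \<and> j < n}" by blast
  qed (auto simp: horizontal_edge_def)
  moreover have "Grid ` grid_edges m n =
      {horizontal_edge m c j | c j. 0 < c \<and> c < m \<and> j < n} \<union> ?V" (is "_ = ?H' \<union> _")
  proof (rule equalityI; rule subsetI)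
    fix e assume "e \<in> Grid ` grid_edges m n"
    then obtain u v where uv: "u \<in> grid_vertices m n" "v \<in> grid_vertices m n" "dist u v = 1"
      "e = Grid {u, v}" by (auto simp: grid_edges_def)
    obtain a b where "u = (a, b)" by (cases u)
    moreover obtain c d where "v = (c, d)" by (cases v)
    ultimately have uv': "u = (a, b)" "v = (c, d)" by simp_all
    have rng: "0 \<le> a" "a < int m" "0 \<le> b" "b < int n" "0 \<le> c" "c < int m" "0 \<le> d" "d < int n"
      using uv uv' by (auto simp: grid_vertices_def)
    consider "a = c" "d = b + 1" | "a = c" "b = d + 1" | "b = d" "c = a + 1" | "b = d" "a = c + 1"
      using uv(3) unfolding uv' prod.case dist_int_pair_eq_1 by linarith
    then show "e \<in> ?H' \<union> ?V"
    proof cases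
      case 1
      then have "e = vertical_edge (nat a) (nat b)" "nat a < m" "Suc (nat b) < n"
        using uv(4) uv' rng by (auto simp: vertical_edge_def)
      then show ?thesis by blast
    next
      case 2
      then have "e = vertical_edge (nat a) (nat d)" "nat a < m" "Suc (nat d) < n"
        using uv(4) uv' rng by (auto simp: vertical_edge_def)
      then show ?thesis by blast
    next
      case 3
      then have "e = horizontal_edge m (nat c) (nat b)" "0 < nat c" "nat c < m" "nat b < n"
        using uv(4) uv' rng by (auto simp: horizontal_edge_def)
      then show ?thesis by blast
    next
      case 4
      then have "e = horizontal_edge m (nat a) (nat b)" "0 < nat a" "nat a < m" "nat b < n"
        using uv(4) uv' rng by (auto simp: horizontal_edge_def)
      then show ?thesis by blast
    qed
  next
    fix e assume "e \<in> ?H' \<union> ?V"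
    then show "e \<in> Grid ` grid_edges m n"
    proof
      assume "e \<in> ?H'"
      then obtain c j where cj: "e = horizontal_edge m c j" "0 < c" "c < m" "j < n" by blast
      have d: "dist (real_of_int (int c - 1), real_of_int (int j)) (real_of_int (int c), real_of_int (int j)) = 1"
        unfolding dist_int_pair_eq_1 by simp
      have "{(int c - 1, int j), (int c, int j)} \<in> grid_edges m n"
        unfolding grid_edges_def
        by (rule CollectI, rule exI[of _ "(int c - 1, int j)"], rule exI[of _ "(int c, int j)"])
           (use d cj in \<open>simp add: grid_vertices_def\<close>)
      then show ?thesis using cj by (simp add: horizontal_edge_def)
    next
      assume "e \<in> ?V"
      then obtain i j where ij: "e = vertical_edge i j" "i < m" "Suc j < n" by blast
      have d: "dist (real_of_int (int i), real_of_int (int j)) (real_of_int (int i), real_of_int (int j + 1)) = 1"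
        unfolding dist_int_pair_eq_1 by simp
      have "{(int i, int j), (int i, int j + 1)} \<in> grid_edges m n"
        unfolding grid_edges_def
        by (rule CollectI, rule exI[of _ "(int i, int j)"], rule exI[of _ "(int i, int j + 1)"])
           (use d ij in \<open>simp add: grid_vertices_def\<close>)
      then show ?thesis using ij by (simp add: vertical_edge_def)
    qed
  qed
  moreover have "?H = {horizontal_edge m c j | c j. c = 0 \<and> j < n} \<union> ?H'"
  proof (rule equalityI; rule subsetI)
    fix e assume "e \<in> ?H"
    then obtain c j where "e = horizontal_edge m c j" "c < m" "j < n" by blast
    moreover have "c = 0 \<or> 0 < c" by auto
    ultimately show "e \<in> {horizontal_edge m c j | c j. c = 0 \<and> j < n} \<union> ?H'" by blast
  next
    fix e assume "e \<in> {horizontal_edge m c j | c j. c = 0 \<and> j < n} \<union> ?H'"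
    then obtain c j where "e = horizontal_edge m c j" "c = 0 \<or> c < m" "j < n" by blast
    moreover have "c < m" using calculation assms by auto
    ultimately show "e \<in> ?H" by blast
  qed
  ultimately show ?thesis by (simp add: cylinder_def Un_ac)
qed

text \<open>The name \<open>vertical_edge i j\<close> may denote a non-edge in the top row; since
  \<open>e\<close> is assumed to be an edge this does no harm.\<close>

lemma incident_cylinder:
  assumes "m \<ge> 2" "e \<in> edges (cylinder m n)" "i < m" "j < n"
  shows "(int i, int j) \<in> cylinder_ends m e \<longleftrightarrow>
    e = horizontal_edge m i j \<or> e = horizontal_edge m (Suc i) j \<or>
    e = vertical_edge i j \<or> (0 < j \<and> e = vertical_edge i (j - 1))"
proof
  assume inc: "(int i, int j) \<in> cylinder_ends m e"
  have "m \<ge> 1" using assms by simp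
  then consider c k where "e = horizontal_edge m c k" "c < m" | c k where "e = vertical_edge c k"
    using assms(2) unfolding edges_cylinder[OF \<open>m \<ge> 1\<close>] by blast
  then show "e = horizontal_edge m i j \<or> e = horizontal_edge m (Suc i) j \<or>
      e = vertical_edge i j \<or> (0 < j \<and> e = vertical_edge i (j - 1))"
  proof cases
    case 1
    show ?thesis
    proof (cases "c = 0")
      case True
      then have "e = Wrap (int k)" using 1 by (simp add: horizontal_edge_def)
      moreover have "k = j \<and> (i = 0 \<or> Suc i = m)" using inc calculation by auto
      ultimately show ?thesis by (auto simp: horizontal_edge_def)
    next
      case False
      then have "k = j \<and> (c = i \<or> c = Suc i)"
        using inc 1 by (auto simp: horizontal_edge_def)
      then show ?thesis using 1 by blast
    qed
  next
    case 2
    then have "c = i \<and> (k = j \<or> j = Suc k)"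
      using inc by (auto simp: vertical_edge_def)
    then show ?thesis using 2 by auto
  qed
next
  assume "e = horizontal_edge m i j \<or> e = horizontal_edge m (Suc i) j \<or>
      e = vertical_edge i j \<or> (0 < j \<and> e = vertical_edge i (j - 1))"
  then show "(int i, int j) \<in> cylinder_ends m e"
    using assms by (auto simp: horizontal_edge_def vertical_edge_def of_nat_diff)
qed

text \<open>The particles of a matching mark its difference from the brick-wall matching formed by the
  horizontal edges with \<open>c + j\<close> odd.\<close>

definition particles :: "nat \<Rightarrow> nat \<Rightarrow> cylinder_edge set \<Rightarrow> (nat \<times> nat) set" where
  "particles m n S = {(c, j). c \<le> m \<and> j < n \<and> (horizontal_edge m c j \<in> S) \<noteq> odd (c + j)}"

definition hops :: "nat \<Rightarrow> nat \<Rightarrow> cylinder_edge set \<Rightarrow> (nat \<times> nat) set" where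
  "hops m n S = {(i, j). i < m \<and> Suc j < n \<and> vertical_edge i j \<in> S}"

definition matching_of :: "nat \<Rightarrow> nat \<Rightarrow> (nat \<times> nat) set \<Rightarrow> (nat \<times> nat) set \<Rightarrow> cylinder_edge set" where
  "matching_of m n H V =
     {horizontal_edge m c j | c j. c < m \<and> j < n \<and> ((c, j) \<in> H) \<noteq> odd (c + j)} \<union>
     {vertical_edge i j | i j. (i, j) \<in> V}"

section \<open>Perfect matchings as particle conservation\<close>

text \<open>Unique existence among different candidates becomes a count. The guard \<open>q\<close>
  is there for the edge below a vertex: in row \<open>0\<close> truncated subtraction would make
  \<open>d\<close> coincide with \<open>c\<close>.\<close>

lemma ex1_incident:
  assumes "a \<noteq> b" "a \<noteq> c" "b \<noteq> c" "q \<Longrightarrow> a \<noteq> d \<and> b \<noteq> d \<and> c \<noteq> d"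
  shows "(\<exists>!e. e \<in> S \<and> (e = a \<or> e = b \<or> e = c \<or> (q \<and> e = d))) \<longleftrightarrow>
    of_bool (a \<in> S) + of_bool (b \<in> S) + (of_bool (c \<in> S) + of_bool (q \<and> d \<in> S)) = (1 :: nat)"
  using assms
  by (cases "a \<in> S"; cases "b \<in> S"; cases "c \<in> S"; cases "q \<and> d \<in> S") auto

text \<open>At a white vertex the left edge belongs to the brick wall, so a particle on the left
  means that this edge is absent and one on the right that the right edge is present; at a black
  vertex the roles are exchanged. "One matching edge" thus turns into conservation.\<close>

lemma perfect_matching_vertex:
  assumes "m \<ge> 2" "S \<subseteq> edges (cylinder m n)" "i < m" "j < n"
  shows "(\<exists>!e. e \<in> S \<and> (int i, int j) \<in> cylinder_ends m e) \<longleftrightarrow>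
    (if odd (i + j)
     then of_bool (j \<in> particles m n S `` {i}) =
       of_bool (j \<in> particles m n S `` {Suc i}) + vertical_degree (hops m n S `` {i}) j
     else of_bool (j \<in> particles m n S `` {Suc i}) =
       of_bool (j \<in> particles m n S `` {i}) + vertical_degree (hops m n S `` {i}) j)"
proof -
  have "(\<exists>!e. e \<in> S \<and> (int i, int j) \<in> cylinder_ends m e) \<longleftrightarrow>
      (\<exists>!e. e \<in> S \<and> (e = horizontal_edge m i j \<or> e = horizontal_edge m (Suc i) j \<or>
        e = vertical_edge i j \<or> (0 < j \<and> e = vertical_edge i (j - 1))))"
    using incident_cylinder[OF assms(1) _ assms(3,4)] assms(2)
    by (intro arg_cong[where f = Ex1] ext) blast
  also have "\<dots> \<longleftrightarrow> of_bool (horizontal_edge m i j \<in> S) + of_bool (horizontal_edge m (Suc i) j \<in> S) +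
      (of_bool (vertical_edge i j \<in> S) + of_bool (0 < j \<and> vertical_edge i (j - 1) \<in> S)) = (1 :: nat)"
    using assms
    by (intro ex1_incident)
       (auto simp: horizontal_edge_neq_Suc horizontal_neq_vertical vertical_edge_inject)
  also have "of_bool (vertical_edge i j \<in> S) + of_bool (0 < j \<and> vertical_edge i (j - 1) \<in> S) =
      vertical_degree (hops m n S `` {i}) j"
  proof -
    \<comment> \<open>Needed for the top row, where \<open>hops\<close> contains nothing:
      \<open>S\<close> consists of edges of the cylinder, so it has no edge above that row.\<close>
    have "Suc j < n" if "vertical_edge i j \<in> S"
    proof -
      have "m \<ge> 1" using assms by simp
      have "vertical_edge i j \<in> edges (cylinder m n)" using that assms by blast
      then show ?thesis
        unfolding edges_cylinder[OF \<open>m \<ge> 1\<close>]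
        using horizontal_neq_vertical by (auto simp: vertical_edge_inject) metis
    qed
    then have "j \<in> hops m n S `` {i} \<longleftrightarrow> vertical_edge i j \<in> S"
      using assms by (auto simp: hops_def)
    moreover have "0 < j \<and> j - 1 \<in> hops m n S `` {i} \<longleftrightarrow> 0 < j \<and> vertical_edge i (j - 1) \<in> S"
      using assms by (auto simp: hops_def)
    ultimately show ?thesis unfolding vertical_degree_def by simp
  qed
  finally have 1: "(\<exists>!e. e \<in> S \<and> (int i, int j) \<in> cylinder_ends m e) \<longleftrightarrow>
      of_bool (horizontal_edge m i j \<in> S) + of_bool (horizontal_edge m (Suc i) j \<in> S) +
        vertical_degree (hops m n S `` {i}) j = 1" .
  have 2: "j \<in> particles m n S `` {i} \<longleftrightarrow> (horizontal_edge m i j \<in> S) \<noteq> odd (i + j)"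
    and 3: "j \<in> particles m n S `` {Suc i} \<longleftrightarrow> (horizontal_edge m (Suc i) j \<in> S) = odd (i + j)"
    using assms by (auto simp: particles_def)
  show ?thesis unfolding 1 2 3
    by (cases "horizontal_edge m i j \<in> S"; cases "horizontal_edge m (Suc i) j \<in> S";
        cases "odd (i + j)") (simp_all add: eq_commute[of "Suc 0"])
qed

lemma perfect_matching_cylinder_iff:
  assumes "m \<ge> 2" "S \<subseteq> edges (cylinder m n)"
  shows "perfect_matching (cylinder m n) S \<longleftrightarrow>
    (\<forall>i<m. compatible i (particles m n S `` {i}) (hops m n S `` {i}) (particles m n S `` {Suc i}))"
proof -
  have V: "vertices (cylinder m n) = {(int i, int j) | i j. i < m \<and> j < n}"
  proof (rule equalityI; rule subsetI)
    fix v assume "v \<in> vertices (cylinder m n)"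
    then obtain a b where v: "v = (a, b)" "0 \<le> a" "a < int m" "0 \<le> b" "b < int n"
      by (auto simp: cylinder_def grid_vertices_def)
    then have "v = (int (nat a), int (nat b))" "nat a < m" "nat b < n" by auto
    then show "v \<in> {(int i, int j) | i j. i < m \<and> j < n}" by blast
  qed (auto simp: cylinder_def grid_vertices_def)
  have E: "ends (cylinder m n) = cylinder_ends m" by (simp add: cylinder_def)
  have out: "vertical_degree (hops m n S `` {i}) j = 0" "j \<notin> particles m n S `` {i}" if "j \<ge> n" for i j
    using that by (auto simp: vertical_degree_def hops_def particles_def)
  have "perfect_matching (cylinder m n) S \<longleftrightarrow>
      (\<forall>i<m. \<forall>j<n. \<exists>!e. e \<in> S \<and> (int i, int j) \<in> cylinder_ends m e)"
    unfolding perfect_matching_def V E using assms(2) by blast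
  also have "\<dots> \<longleftrightarrow> (\<forall>i<m. compatible i (particles m n S `` {i}) (hops m n S `` {i})
      (particles m n S `` {Suc i}))"
  proof (intro all_cong)
    fix i assume i: "i < m"
    let ?c = "\<lambda>j. if odd (i + j)
     then of_bool (j \<in> particles m n S `` {i}) =
       of_bool (j \<in> particles m n S `` {Suc i}) + vertical_degree (hops m n S `` {i}) j
     else of_bool (j \<in> particles m n S `` {Suc i}) =
       of_bool (j \<in> particles m n S `` {i}) + vertical_degree (hops m n S `` {i}) j"
    \<comment> \<open>\<open>compatible\<close> ranges over all sites; beyond the path every term
      vanishes.\<close>
    have "?c j" if "j \<ge> n" for j using out[OF that] by simp
    then have "(\<forall>j<n. ?c j) \<longleftrightarrow> (\<forall>j. ?c j)" by (metis linorder_not_le)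
    then show "(\<forall>j<n. \<exists>!e. e \<in> S \<and> (int i, int j) \<in> cylinder_ends m e) \<longleftrightarrow>
        compatible i (particles m n S `` {i}) (hops m n S `` {i}) (particles m n S `` {Suc i})"
      unfolding compatible_def using perfect_matching_vertex[OF assms i] by simp
  qed
  finally show ?thesis .
qed

section \<open>The bijection with closed configurations\<close>

lemma matching_of_particles_hops:
  assumes "m \<ge> 1" "S \<subseteq> edges (cylinder m n)"
  shows "matching_of m n (particles m n S) (hops m n S) = S"
proof (rule equalityI; rule subsetI)
  fix e assume "e \<in> matching_of m n (particles m n S) (hops m n S)"
  then show "e \<in> S" by (auto simp: matching_of_def particles_def hops_def)
next
  fix e assume e: "e \<in> S"
  then have "e \<in> edges (cylinder m n)" using assms(2) by blast
  then consider c j where "e = horizontal_edge m c j" "c < m" "j < n"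
    | i j where "e = vertical_edge i j" "i < m" "Suc j < n"
    unfolding edges_cylinder[OF assms(1)] by blast
  then show "e \<in> matching_of m n (particles m n S) (hops m n S)"
  proof cases
    case 1
    then have "((c, j) \<in> particles m n S) \<noteq> odd (c + j)" using e by (simp add: particles_def)
    then show ?thesis using 1 unfolding matching_of_def by blast
  next
    case 2
    then have "(i, j) \<in> hops m n S" using e by (simp add: hops_def)
    then show ?thesis using 2 unfolding matching_of_def by blast
  qed
qed

text \<open>A matching stores the wrap edges once, so column \<open>m\<close> is recovered from
  column \<open>0\<close>. This uses that \<open>H\<close> is closed and that even \<open>m\<close>
  gives both columns the same brick-wall parity.\<close>

lemma particles_matching_of:
  assumes "m \<ge> 1" "even m" "H \<subseteq> {..m} \<times> {..<n}" "H `` {0} = H `` {m}"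
  shows "particles m n (matching_of m n H V) = H"
proof -
  have mem: "horizontal_edge m c j \<in> matching_of m n H V \<longleftrightarrow> ((c, j) \<in> H) \<noteq> odd (c + j)"
    if "c < m" "j < n" for c j
    using that horizontal_neq_vertical[of m c j]
    by (auto simp: matching_of_def horizontal_edge_inject)
  have "(c, j) \<in> particles m n (matching_of m n H V) \<longleftrightarrow> (c, j) \<in> H" if "c \<le> m" "j < n" for c j
  proof (cases "c = m")
    case False
    then have "(c, j) \<in> particles m n (matching_of m n H V) \<longleftrightarrow>
        (horizontal_edge m c j \<in> matching_of m n H V) \<noteq> odd (c + j)" "c < m"
      using that by (simp_all add: particles_def)
    then show ?thesis using mem[OF \<open>c < m\<close> that(2)] by blast
  next
    case True
    have "horizontal_edge m m j = horizontal_edge m 0 j" by (simp add: horizontal_edge_def)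
    then have "(c, j) \<in> particles m n (matching_of m n H V) \<longleftrightarrow>
        (horizontal_edge m 0 j \<in> matching_of m n H V) \<noteq> odd (0 + j)"
      using that True assms(2) by (simp add: particles_def)
    moreover have "(0, j) \<in> H \<longleftrightarrow> (m, j) \<in> H" using assms(4) by auto
    moreover have "horizontal_edge m 0 j \<in> matching_of m n H V \<longleftrightarrow> ((0, j) \<in> H) \<noteq> odd (0 + j)"
      using assms(1) that by (intro mem) simp_all
    ultimately show ?thesis using True by blast
  qed
  moreover have "particles m n (matching_of m n H V) \<subseteq> {..m} \<times> {..<n}"
    by (auto simp: particles_def)
  ultimately show ?thesis using assms(3) by auto
qed

lemma hops_matching_of:
  assumes "V \<subseteq> {..<m} \<times> {..<n - 1}"
  shows "hops m n (matching_of m n H V) = V"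
proof -
  have "vertical_edge i j \<in> matching_of m n H V \<longleftrightarrow> (i, j) \<in> V" for i j
    using horizontal_neq_vertical[of m _ _ i j, symmetric]
    by (auto simp: matching_of_def vertical_edge_inject)
  then show ?thesis using assms by (auto simp: hops_def)
qed

lemma bij_betw_matchings_configurations:
  assumes "m \<ge> 2" "even m"
  shows "bij_betw (\<lambda>S. (particles m n S, hops m n S)) {S. perfect_matching (cylinder m n) S}
    (\<Union>P\<in>Pow {..<n}. configurations n m P P)"
proof (rule bij_betw_byWitness[where f' = "\<lambda>(H, V). matching_of m n H V"])
  let ?C = "\<Union>P\<in>Pow {..<n}. configurations n m P P"
  have m1: "m \<ge> 1" using assms by simp
  have inverse: "particles m n (matching_of m n H V) = H \<and> hops m n (matching_of m n H V) = V"
    if "(H, V) \<in> ?C" for H V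
    using that particles_matching_of[OF m1 assms(2), of H n V] hops_matching_of[of V m n H]
    by (auto simp: configurations_def)
  show "\<forall>S\<in>{S. perfect_matching (cylinder m n) S}.
      (case (particles m n S, hops m n S) of (H, V) \<Rightarrow> matching_of m n H V) = S"
    using matching_of_particles_hops[OF m1] by (auto simp: perfect_matching_def)
  show "\<forall>a\<in>?C. (particles m n (case a of (H, V) \<Rightarrow> matching_of m n H V),
      hops m n (case a of (H, V) \<Rightarrow> matching_of m n H V)) = a"
  proof
    fix a assume "a \<in> ?C"
    then show "(particles m n (case a of (H, V) \<Rightarrow> matching_of m n H V),
        hops m n (case a of (H, V) \<Rightarrow> matching_of m n H V)) = a"
      using inverse[of "fst a" "snd a"] by (simp add: case_prod_beta)
  qed
  show "(\<lambda>S. (particles m n S, hops m n S)) ` {S. perfect_matching (cylinder m n) S} \<subseteq> ?C"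
  proof (rule image_subsetI)
    fix S assume "S \<in> {S. perfect_matching (cylinder m n) S}"
    then have S: "perfect_matching (cylinder m n) S" "S \<subseteq> edges (cylinder m n)"
      by (auto simp: perfect_matching_def)
    have "horizontal_edge m m j = horizontal_edge m 0 j" for j by (simp add: horizontal_edge_def)
    then have "particles m n S `` {m} = particles m n S `` {0}"
      using assms(2) by (auto simp: particles_def)
    moreover have "particles m n S \<subseteq> {..m} \<times> {..<n}" "hops m n S \<subseteq> {..<m} \<times> {..<n - 1}"
      by (auto simp: particles_def hops_def)
    ultimately have "(particles m n S, hops m n S) \<in>
        configurations n m (particles m n S `` {0}) (particles m n S `` {0})"
      using perfect_matching_cylinder_iff[OF assms(1) S(2)] S(1) by (simp add: configurations_def)
    moreover have "particles m n S `` {0} \<in> Pow {..<n}" by (auto simp: particles_def)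
    ultimately show "(particles m n S, hops m n S) \<in> ?C" by blast
  qed
  show "(\<lambda>(H, V). matching_of m n H V) ` ?C \<subseteq> {S. perfect_matching (cylinder m n) S}"
  proof (rule image_subsetI)
    fix a assume a: "a \<in> ?C"
    obtain H V where HV: "a = (H, V)" by (cases a)
    have V: "V \<subseteq> {..<m} \<times> {..<n - 1}"
      and c: "\<forall>i<m. compatible i (H `` {i}) (V `` {i}) (H `` {Suc i})"
      using a HV by (auto simp: configurations_def)
    have "matching_of m n H V \<subseteq> edges (cylinder m n)"
      unfolding edges_cylinder[OF m1] matching_of_def using V by fastforce
    then have "perfect_matching (cylinder m n) (matching_of m n H V)"
      using perfect_matching_cylinder_iff[OF assms(1)] inverse[of H V] a HV c by simp
    then show "(case a of (H, V) \<Rightarrow> matching_of m n H V) \<in> {S. perfect_matching (cylinder m n) S}"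
      by (simp add: HV)
  qed
qed

lemma num_perfect_matchings_cylinder_walks:
  assumes "m \<ge> 2" "even m" "n \<ge> 1"
  shows "num_perfect_matchings (cylinder m n) =
    (\<Sum>P\<in>Pow {..<n}. num_walks (cylinder_moves n m) P P)"
proof -
  have "num_perfect_matchings (cylinder m n) = card (\<Union>P\<in>Pow {..<n}. configurations n m P P)"
    unfolding num_perfect_matchings_def
    by (rule bij_betw_same_card[OF bij_betw_matchings_configurations[OF assms(1,2)]])
  \<comment> \<open>The union is disjoint because \<open>P\<close> is the first column of
    \<open>H\<close>.\<close>
  also have "\<dots> = (\<Sum>P\<in>Pow {..<n}. card (configurations n m P P))"
    by (rule card_UN_disjoint)
       (simp, simp add: finite_configurations, fastforce simp: configurations_def)
  also have "\<dots> = (\<Sum>P\<in>Pow {..<n}. num_walks (cylinder_moves n m) P P)"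
    using num_walks_cylinder[OF assms(3)] by (intro sum.cong refl) simp
  finally show ?thesis .
qed

section \<open>Eigenvalues\<close>

text \<open>White entries are changed using black entries only, and these stay fixed throughout the
  column, so the successive moves act like one simultaneous update.\<close>

lemma move_apply_column:
  "move_apply (column_moves i r @ ms) x = move_apply ms (\<lambda>j. if odd (i + j)
     then x j + (if j < r then x (Suc j) else 0) + (if 0 < j \<and> j \<le> r then x (j - 1) else 0)
     else x j)"
proof (induction r arbitrary: x)
  case 0
  have "(\<lambda>j. if odd (i + j) then x j + (if j < 0 then x (Suc j) else 0) +
      (if 0 < j \<and> j \<le> 0 then x (j - 1) else 0) else x j) = x"
    by (intro ext) simp
  then show ?case by simp
next
  case (Suc r)
  obtain w b where mv: "edge_move i r = (w, b)" by (cases "edge_move i r")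
  let ?y = "x(w := x w + x b)"
  have "(if odd (i + j)
        then ?y j + (if j < r then ?y (Suc j) else 0) + (if 0 < j \<and> j \<le> r then ?y (j - 1) else 0)
        else ?y j) =
      (if odd (i + j)
        then x j + (if j < Suc r then x (Suc j) else 0) + (if 0 < j \<and> j \<le> Suc r then x (j - 1) else 0)
        else x j)" for j
  proof (cases "odd (i + j)")
    case False
    then have "j \<noteq> w" using mv by (auto simp: edge_move_def split: if_splits)
    then show ?thesis using False by simp
  next
    case odd: True
    have "odd (i + w)" using mv by (auto simp: edge_move_def split: if_splits)
    then have nb: "Suc j \<noteq> w" "0 < j \<Longrightarrow> j - 1 \<noteq> w"
      using odd by auto
    show ?thesis
    proof (cases "odd (i + r)")
      case True
      then have "w = r" "b = Suc r" using mv by (auto simp: edge_move_def)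
      moreover have "j \<noteq> Suc r" using odd True by auto
      ultimately show ?thesis using odd nb by (auto simp: less_Suc_eq le_Suc_eq)
    next
      case False
      then have "w = Suc r" "b = r" using mv by (auto simp: edge_move_def)
      moreover have "j \<noteq> r" using odd False by auto
      ultimately show ?thesis using odd nb by (auto simp: less_Suc_eq le_Suc_eq)
    qed
  qed
  then show ?case by (simp add: mv Suc.IH cong: if_cong)
qed

section \<open>Standing waves\<close>

text \<open>The sites are numbered from \<open>0\<close>, hence \<open>Suc j\<close>: the sine has
  its zeros at the two phantom sites just outside the path. Separate amplitudes are kept for even
  and odd sites because a column updates only one of these classes.\<close>

definition wave :: "nat \<Rightarrow> real \<Rightarrow> real \<Rightarrow> real \<Rightarrow> nat \<Rightarrow> real" where
  "wave n t \<alpha> \<beta> j = (if j < n then (if even j then \<alpha> else \<beta>) * sin (real (Suc j) * t) else 0)"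

text \<open>A missing neighbour at either end of the path may be counted as present, since the sine
  vanishes there; then the addition theorem applies.\<close>

lemma sin_neighbours:
  assumes "sin (real (Suc n) * t) = 0" "j < n"
  shows "(if j < n - 1 then sin (real (Suc (Suc j)) * t) else 0) + (if 0 < j then sin (real j * t) else 0) =
    2 * cos t * sin (real (Suc j) * t)"
proof -
  have "(if j < n - 1 then sin (real (Suc (Suc j)) * t) else 0) = sin (real (Suc (Suc j)) * t)"
  proof (cases "j < n - 1")
    case False
    then have "n = Suc j" using assms(2) by simp
    then show ?thesis using assms(1) False by simp
  qed simp
  moreover have "(if 0 < j then sin (real j * t) else 0) = sin (real j * t)" by simp
  moreover have "sin (real (Suc j) * t + t) + sin (real (Suc j) * t - t) = 2 * cos t * sin (real (Suc j) * t)"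
    by (simp add: sin_add sin_diff)
  moreover have "real (Suc (Suc j)) * t = real (Suc j) * t + t" "real j * t = real (Suc j) * t - t"
    by (simp_all add: algebra_simps)
  ultimately show ?thesis by simp
qed

lemma move_apply_column_wave:
  assumes "sin (real (Suc n) * t) = 0"
  shows "move_apply (column_moves i (n - 1) @ ms) (wave n t \<alpha> \<beta>) = move_apply ms
    (if odd i then wave n t (\<alpha> + 2 * cos t * \<beta>) \<beta> else wave n t \<alpha> (\<beta> + 2 * cos t * \<alpha>))"
proof -
  let ?x = "wave n t \<alpha> \<beta>"
  have "(if odd (i + j)
       then ?x j + (if j < n - 1 then ?x (Suc j) else 0) + (if 0 < j \<and> j \<le> n - 1 then ?x (j - 1) else 0)
       else ?x j) =
      (if odd i then wave n t (\<alpha> + 2 * cos t * \<beta>) \<beta> else wave n t \<alpha> (\<beta> + 2 * cos t * \<alpha>)) j" for j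
  proof (cases "odd (i + j) \<and> j < n")
    case False
    then show ?thesis by (auto simp: wave_def)
  next
    case True
    let ?c = "if even j then \<beta> else \<alpha>"
    have "(if j < n - 1 then ?x (Suc j) else 0) = ?c * (if j < n - 1 then sin (real (Suc (Suc j)) * t) else 0)"
    proof -
      have "j < n - 1 \<longleftrightarrow> Suc j < n" by arith
      then show ?thesis by (simp add: wave_def)
    qed
    moreover have "(if 0 < j \<and> j \<le> n - 1 then ?x (j - 1) else 0) = ?c * (if 0 < j then sin (real j * t) else 0)"
      using True by (cases j) (auto simp: wave_def)
    ultimately have "(if j < n - 1 then ?x (Suc j) else 0) + (if 0 < j \<and> j \<le> n - 1 then ?x (j - 1) else 0) =
        ?c * (2 * cos t * sin (real (Suc j) * t))"
      using sin_neighbours[OF assms, of j] True by (simp only: distrib_left[symmetric])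
    then show ?thesis
      using True by (cases "even j") (simp_all add: wave_def algebra_simps)
  qed
  then show ?thesis
    unfolding move_apply_column by (intro arg_cong[where f = "move_apply ms"] ext)
qed

text \<open>Two columns map the amplitudes \<open>(\<alpha>, \<alpha> \<lambda>)\<close> to \<open>(\<alpha> + 2 cos t \<alpha> \<lambda>, \<dots>)\<close>, which is
  \<open>\<lambda>\<^sup>2 (\<alpha>, \<alpha> \<lambda>)\<close> when \<open>\<lambda> - 1 / \<lambda> = 2 cos t\<close>.\<close>

lemma move_apply_cylinder_wave:
  assumes "sin (real (Suc n) * t) = 0" "l\<^sup>2 = 1 + 2 * cos t * l"
  shows "move_apply (cylinder_moves n (2 * q)) (wave n t \<alpha> (\<alpha> * l)) =
    wave n t (l ^ (2 * q) * \<alpha>) (l ^ (2 * q) * \<alpha> * l)"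
proof (induction q arbitrary: \<alpha>)
  case 0
  then show ?case by simp
next
  case (Suc q)
  have a: "\<alpha> + 2 * cos t * (\<alpha> * l) = \<alpha> * l\<^sup>2" by (simp add: assms(2) algebra_simps)
  have b: "\<alpha> * l + 2 * cos t * (\<alpha> * l\<^sup>2) = \<alpha> * l\<^sup>2 * l"
  proof -
    have "\<alpha> * l + 2 * cos t * (\<alpha> * l\<^sup>2) = \<alpha> * l * (1 + 2 * cos t * l)"
      by (simp add: algebra_simps power2_eq_square)
    then show ?thesis by (simp add: assms(2)[symmetric] power2_eq_square)
  qed
  have "cylinder_moves n (2 * Suc q) =
      column_moves (Suc (2 * q)) (n - 1) @ column_moves (2 * q) (n - 1) @ cylinder_moves n (2 * q)"
    by simp
  then have "move_apply (cylinder_moves n (2 * Suc q)) (wave n t \<alpha> (\<alpha> * l)) =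
      move_apply (cylinder_moves n (2 * q)) (wave n t (\<alpha> * l\<^sup>2) (\<alpha> * l\<^sup>2 * l))"
    using move_apply_column_wave[OF assms(1)] by (simp add: a b)
  also have "\<dots> = wave n t (l ^ (2 * q) * (\<alpha> * l\<^sup>2)) (l ^ (2 * q) * (\<alpha> * l\<^sup>2) * l)"
    by (rule Suc.IH)
  also have "l ^ (2 * q) * (\<alpha> * l\<^sup>2) = l ^ (2 * Suc q) * \<alpha>"
    by (simp add: power2_eq_square algebra_simps)
  finally show ?case .
qed

text \<open>The waves with \<open>t = k * pi / (n + 1)\<close> vanish at both phantom sites, and the
  \<open>n\<close> positive roots already give \<open>n\<close> different eigenvalues.\<close>

lemma num_perfect_matchings_cylinder_eq_prod:
  fixes m n :: nat
  defines "c \<equiv> \<lambda>k. cos (real k * pi / (real n + 1))"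
  assumes "m \<ge> 2" "even m" "n \<ge> 1"
  shows "real (num_perfect_matchings (cylinder m n)) =
    (\<Prod>k=1..n. 1 + (c k + sqrt (1 + (c k)\<^sup>2)) ^ m)"
proof -
  define t where "t k = real k * pi / (real n + 1)" for k
  define l where "l k = c k + sqrt (1 + (c k)\<^sup>2)" for k
  have c: "c k = cos (t k)" for k by (simp add: c_def t_def)
  have t: "0 < t k" "t k < pi" if "k \<in> {1..n}" for k
  proof -
    have "real k * pi < (real n + 1) * pi"
      using that by (intro mult_strict_right_mono) auto
    then show "t k < pi" by (simp add: t_def divide_less_eq mult.commute)
    show "0 < t k" using that by (simp add: t_def)
  qed
  have sin_t: "sin (real (Suc n) * t k) = 0" for k
  proof -
    have "real (Suc n) * t k = real k * pi" by (simp add: t_def field_simps)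
    then show ?thesis by simp
  qed
  have l_pos: "l k > 0" for k
  proof -
    have "\<bar>c k\<bar> < sqrt (1 + (c k)\<^sup>2)" by (rule real_less_rsqrt) simp
    then show ?thesis by (simp add: l_def)
  qed
  have l_sq: "(l k)\<^sup>2 = 1 + 2 * c k * l k" for k
  proof -
    have "(sqrt (1 + (c k)\<^sup>2))\<^sup>2 = 1 + (c k)\<^sup>2" by simp
    then show ?thesis unfolding l_def power2_sum by (simp only:) (simp add: power2_eq_square algebra_simps)
  qed
  have inj_l: "inj_on l {1..n}"
  proof (rule inj_onI)
    fix x y assume xy: "x \<in> {1..n}" "y \<in> {1..n}" "l x = l y"
    \<comment> \<open>Since \<open>l\<close> is nonzero, the quadratic equation recovers
      \<open>2 * c = l - 1 / l\<close> from \<open>l\<close>.\<close>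
    then have "c x = c y" using l_sq[of x] l_sq[of y] l_pos[of y] by simp
    then have "t x = t y" using t[OF xy(1)] t[OF xy(2)] by (simp add: c cos_inj_pi)
    then show "x = y" by (simp add: t_def)
  qed
  let ?M = "cylinder_moves n m"
  have adj: "\<forall>(w, b) \<in> set ?M. w = Suc b \<or> b = Suc w" "\<forall>(w, b) \<in> set ?M. w < n \<and> b < n \<and> w \<noteq> b"
    by (auto dest: cylinder_moves_adjacent[OF assms(4)])
  obtain q where q: "m = 2 * q" using assms(3) by (rule evenE)
  have "(\<Sum>P\<in>Pow {..<n}. leibniz_minor (move_matrix ?M) P id) = (\<Prod>k\<in>{1..n}. 1 + l k ^ m)"
  proof (rule sum_principal_minors_eigenvalues)
    fix k i assume k: "k \<in> {1..n}" and i: "i < n"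
    have "(\<Sum>j<n. move_matrix ?M i j * wave n (t k) 1 (l k) j) = move_apply ?M (wave n (t k) 1 (l k)) i"
      using adj(2) i by (rule move_matrix_mult)
    also have "\<dots> = wave n (t k) (l k ^ m) (l k ^ m * l k) i"
      using move_apply_cylinder_wave[OF sin_t, of "l k" k q 1] l_sq[of k] by (simp add: q c)
    also have "\<dots> = l k ^ m * wave n (t k) 1 (l k) i" by (simp add: wave_def)
    finally show "(\<Sum>j<n. move_matrix ?M i j * wave n (t k) 1 (l k) j) = l k ^ m * wave n (t k) 1 (l k) i" .
  next
    fix k assume k: "k \<in> {1..n}"
    have "sin (t k) > 0" using t[OF k] by (rule sin_gt_zero)
    then show "\<exists>i<n. wave n (t k) 1 (l k) i \<noteq> 0"
      using assms(4) by (intro exI[of _ 0]) (simp add: wave_def)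
  next
    show "inj_on (\<lambda>k. l k ^ m) {1..n}"
    proof (rule inj_onI)
      fix x y assume xy: "x \<in> {1..n}" "y \<in> {1..n}" "l x ^ m = l y ^ m"
      then have "l x = l y"
        \<comment> \<open>Positivity is essential here: an even power does not separate
          \<open>l\<close> from \<open>- l\<close>.\<close>
        using power_eq_iff_eq_base[of m "l x" "l y"] l_pos[of x] l_pos[of y] assms(2) by simp
      then show "x = y" using inj_l xy by (auto dest: inj_onD)
    qed
  qed simp_all
  then show ?thesis
    using sum_closed_walks[OF adj(1), of n]
    by (simp add: num_perfect_matchings_cylinder_walks[OF assms(2-4)] l_def)
qed

section \<open>Reflection symmetry of the product\<close>

text \<open>The reflection exchanges the lower and the upper half of the indices; for odd
  \<open>n\<close> the middle index is its own image.\<close>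

lemma prod_symmetric:
  fixes g :: "nat \<Rightarrow> real"
  assumes "\<And>k. k \<in> {1..n} \<Longrightarrow> g (n + 1 - k) = g k"
  shows "prod g {1..n} = (prod g {1..n div 2})\<^sup>2 * (if odd n then g (n div 2 + 1) else 1)"
proof -
  let ?h = "n div 2"
  have "prod g {n - ?h + 1..n} = prod g {1..?h}"
    by (rule prod.reindex_bij_witness[where i = "\<lambda>k. n + 1 - k" and j = "\<lambda>k. n + 1 - k"])
       (use assms in auto)
  moreover have "{1..n} = {1..?h} \<union> (if odd n then {?h + 1} else {}) \<union> {n - ?h + 1..n}"
    by (auto elim!: oddE evenE)
  moreover have "prod g ({1..?h} \<union> (if odd n then {?h + 1} else {}) \<union> {n - ?h + 1..n}) =
      prod g {1..?h} * (if odd n then g (?h + 1) else 1) * prod g {n - ?h + 1..n}"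
    by (subst prod.union_disjoint; auto elim!: oddE evenE)+
  ultimately show ?thesis by (simp add: power2_eq_square)
qed

theorem theorem5p1:
  fixes m n :: nat
  assumes "m \<ge> 2" and "even m" and "n \<ge> 1"
  shows "real (num_perfect_matchings (cylinder m n)) =
      sqrt (\<Prod>k=1..n.
        (1 + (cos (real k * pi / (real n + 1)) + sqrt (1 + (cos (real k * pi / (real n + 1)))\<^sup>2)) ^ m) *
        (1 + (cos (real k * pi / (real n + 1)) - sqrt (1 + (cos (real k * pi / (real n + 1)))\<^sup>2)) ^ m))
    \<and>
      sqrt (\<Prod>k=1..n.
        (1 + (cos (real k * pi / (real n + 1)) + sqrt (1 + (cos (real k * pi / (real n + 1)))\<^sup>2)) ^ m) *
        (1 + (cos (real k * pi / (real n + 1)) - sqrt (1 + (cos (real k * pi / (real n + 1)))\<^sup>2)) ^ m))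
      = 2 ^ (n - 2 * (n div 2)) *
        (\<Prod>k=1..n div 2.
        (1 + (cos (real k * pi / (real n + 1)) + sqrt (1 + (cos (real k * pi / (real n + 1)))\<^sup>2)) ^ m) *
        (1 + (cos (real k * pi / (real n + 1)) - sqrt (1 + (cos (real k * pi / (real n + 1)))\<^sup>2)) ^ m))"
proof -
  define c where "c k = cos (real k * pi / (real n + 1))" for k
  define f where "f k = 1 + (c k + sqrt (1 + (c k)\<^sup>2)) ^ m" for k
  define f' where "f' k = 1 + (c k - sqrt (1 + (c k)\<^sup>2)) ^ m" for k
  let ?g = "\<lambda>k. f k * f' k"
  have M: "real (num_perfect_matchings (cylinder m n)) = prod f {1..n}"
    using num_perfect_matchings_cylinder_eq_prod[OF assms] by (simp add: f_def c_def)
  have c_rev: "c (n + 1 - k) = - c k" if "k \<in> {1..n}" for k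
  proof -
    have "real (n + 1 - k) * pi / (real n + 1) = pi - real k * pi / (real n + 1)"
      using that by (simp add: of_nat_diff field_simps)
    then show ?thesis unfolding c_def by (simp only: cos_pi_minus)
  qed
  \<comment> \<open>Reflection negates the cosine, which turns one root into the negative of the
    other; the even exponent removes that sign.\<close>
  have f_rev: "f (n + 1 - k) = f' k" if "k \<in> {1..n}" for k
    unfolding f_def f'_def c_rev[OF that] power2_minus
    using power_minus_even[OF assms(2), of "c k - sqrt (1 + (c k)\<^sup>2)"] by simp
  have f'_rev: "f' (n + 1 - k) = f k" if "k \<in> {1..n}" for k
    unfolding f_def f'_def c_rev[OF that] power2_minus
    using power_minus_even[OF assms(2), of "c k + sqrt (1 + (c k)\<^sup>2)"] by simp
  have pos: "f k > 0 \<and> f' k > 0" for k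
    unfolding f_def f'_def
    using zero_le_even_power[OF assms(2), of "c k + sqrt (1 + (c k)\<^sup>2)"]
      zero_le_even_power[OF assms(2), of "c k - sqrt (1 + (c k)\<^sup>2)"] by linarith
  have "prod f' {1..n} = prod f {1..n}"
    by (rule prod.reindex_bij_witness[where i = "\<lambda>k. n + 1 - k" and j = "\<lambda>k. n + 1 - k"])
       (use f_rev in auto)
  then have "prod ?g {1..n} = (prod f {1..n})\<^sup>2"
    by (simp add: prod.distrib power2_eq_square)
  moreover have "prod f {1..n} \<ge> 0"
    by (rule prod_nonneg) (simp add: pos less_imp_le)
  ultimately have 1: "sqrt (prod ?g {1..n}) = prod f {1..n}" by simp
  \<comment> \<open>At the middle index the cosine is \<open>0\<close>, so the roots are
    \<open>1\<close> and \<open>-1\<close> and each factor equals \<open>2\<close>.\<close>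
  have mid: "?g (n div 2 + 1) = 4" if "odd n"
  proof -
    from that obtain h where h: "n = 2 * h + 1" by (rule oddE)
    then have "real (n div 2 + 1) * pi / (real n + 1) = pi / 2" by (simp add: field_simps)
    then have "c (n div 2 + 1) = 0" unfolding c_def by (simp only: cos_pi_half)
    then show ?thesis using assms(2) by (simp add: f_def f'_def)
  qed
  have "prod ?g {1..n} = (prod ?g {1..n div 2})\<^sup>2 * (if odd n then ?g (n div 2 + 1) else 1)"
    by (rule prod_symmetric) (use f_rev f'_rev in simp)
  \<comment> \<open>The exponent is \<open>1\<close> for odd and \<open>0\<close> for even
    \<open>n\<close>, so the middle value \<open>4\<close> is the square of the power of
    two.\<close>
  also have "\<dots> = (2 ^ (n - 2 * (n div 2)) * prod ?g {1..n div 2})\<^sup>2"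
    using mid by (auto simp: power_mult_distrib elim!: oddE evenE)
  finally have "sqrt (prod ?g {1..n}) = \<bar>2 ^ (n - 2 * (n div 2)) * prod ?g {1..n div 2}\<bar>"
    by (simp only: real_sqrt_abs)
  moreover have "2 ^ (n - 2 * (n div 2)) * prod ?g {1..n div 2} \<ge> 0"
    by (intro mult_nonneg_nonneg prod_nonneg) (simp_all add: pos less_imp_le)
  ultimately have 2: "sqrt (prod ?g {1..n}) = 2 ^ (n - 2 * (n div 2)) * prod ?g {1..n div 2}"
    by (simp only: abs_of_nonneg)
  show ?thesis
    using M 1 2 unfolding f_def f'_def c_def by simp
qed

end
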